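(* Let $m\ge 1$ be an integer, $\delta_0,\delta_1\in(-m,+\infty)$, and let $(\tau_n)_{n\ge1}$ be integers with $1\le \tau_n\le n$ and $\Delta_n=n-\tau_n$. Assume that either $\delta_0>0$ and $\Delta_n=o(n^{1/3})$, or $\delta_0=0$ and $\Delta_n=o\big(n^{1/3}/\log(n)\big)$. Then for every sequence of events $(A_n)_{n\ge1}$ with $A_n\in\sigma(s(G_n))$ for all $n\ge1$, $$\mathbb{P}_0^n(A_n)\to 0\implies \mathbb{P}_1^n(A_n)\to 0 .$$
   Context: A labeled graph $\mathfrak g$ is a finite directed multigraph without loops; $\mu_{\mathfrak g}(u,v)$ is the number of directed edges $u\to v$, and the degree $\mathrm d_{\mathfrak g}(v)$ is the in-degree plus the out-degree of $v$, counted with multiplicity. Two labeled graphs are isomorphic if there is a bijection of their vertex sets preserving all the multiplicities $\mu$; the structure (unlabeled graph) $s(\mathfrak g)$ is the isomorphism class of $\mathfrak g$. Preferential attachment with parameter function $\delta:\mathbb N\to(-m,+\infty)$: $G_{1,0}$ consists of two isolated vertices $0,1$; for $i=1,\dots,m$, $G_{1,i}$ is obtained from $G_{1,i-1}$ by adding an edge directed from $1$ to $0$. For $t\ge2$, $G_{t,0}$ is $G_{t-1,m}$ together with an isolated vertex $t$; for $i=1,\dots,m$, $G_{t,i}$ is obtained from $G_{t,i-1}$ by adding an edge directed from $t$ to a random vertex $V_{t,i}\in\{0,\dots,t-1\}$ where, conditionally on the past, $V_{t,i}=v$ with probability $$\frac{\mathrm d_{G_{t,i-1}}(v)+\delta(t)}{2m(t-1)+\delta(t)t+(i-1)}.$$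 Set $G_t=G_{t,m}$, a graph on $\{0,\dots,t\}$. For each $n$, $\mathbb P_0^n$ is the probability under which the process up to time $n$ is generated with $\delta(t)=\delta_0$ for all $t$, and $\mathbb P_1^n$ the probability under which it is generated with $\delta(t)=\delta_0\mathbf 1_{t\le\tau_n}+\delta_1\mathbf 1_{t>\tau_n}$. *)

theory Defs
  imports "HOL-Probability.Probability" "HOL-Library.Landau_Symbols" "HOL-Library.Multiset"
begin

text \<open>Edges carry no identity: a multigraph is determined by its vertices and the multiplicities
  of its edges. The pair \<open>(u, v)\<close> is an edge directed from \<open>u\<close> to \<open>v\<close>.\<close>

record 'a mgraph =
  verts :: "'a set"
  edges :: "('a \<times> 'a) multiset"

definition labeled_graph :: "'a mgraph \<Rightarrow> bool" where
  "labeled_graph g \<longleftrightarrow> finite (verts g) \<and>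
     (\<forall>(u, v) \<in># edges g. u \<in> verts g \<and> v \<in> verts g \<and> u \<noteq> v)"

definition mult :: "'a mgraph \<Rightarrow> 'a \<Rightarrow> 'a \<Rightarrow> nat" where
  "mult g u v = count (edges g) (u, v)"

definition in_deg :: "'a mgraph \<Rightarrow> 'a \<Rightarrow> nat" where
  "in_deg g v = size {#e \<in># edges g. snd e = v#}"

definition out_deg :: "'a mgraph \<Rightarrow> 'a \<Rightarrow> nat" where
  "out_deg g v = size {#e \<in># edges g. fst e = v#}"

definition deg :: "'a mgraph \<Rightarrow> 'a \<Rightarrow> nat" where
  "deg g v = in_deg g v + out_deg g v"

definition graph_iso :: "'a mgraph \<Rightarrow> 'b mgraph \<Rightarrow> bool" where
  "graph_iso g h \<longleftrightarrow> (\<exists>\<phi>. bij_betw \<phi> (verts g) (verts h) \<and>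
     (\<forall>u \<in> verts g. \<forall>v \<in> verts g. mult g u v = mult h (\<phi> u) (\<phi> v)))"

text \<open>The structure of a graph is its isomorphism class among the labeled graphs whose
  vertices are drawn from the same type.\<close>

definition graph_structure :: "'a mgraph \<Rightarrow> 'a mgraph set" where
  "graph_structure g = {h. labeled_graph h \<and> graph_iso g h}"

definition add_vertex :: "'a \<Rightarrow> 'a mgraph \<Rightarrow> 'a mgraph" where
  "add_vertex v g = g\<lparr>verts := insert v (verts g)\<rparr>"

definition add_edge :: "'a \<Rightarrow> 'a \<Rightarrow> 'a mgraph \<Rightarrow> 'a mgraph" where
  "add_edge u v g = g\<lparr>edges := add_mset (u, v) (edges g)\<rparr>"


text \<open>A sample point is the whole trajectory of the process, as the list of all graphs
  \<open>G\<^bsub>t,i\<^esub>\<close> built so far, the most recent one first.\<close>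

type_synonym path = "nat mgraph list"

primrec initial_graph :: "nat \<Rightarrow> nat mgraph" where
  "initial_graph 0 = \<lparr>verts = {0, 1}, edges = {#}\<rparr>"
| "initial_graph (Suc i) = add_edge 1 0 (initial_graph i)"

text \<open>The law of \<open>V\<^bsub>t,i\<^esub>\<close> given \<open>G\<^bsub>t,i-1\<^esub> = g\<close>. The function embedded here is a probability
  mass function for all graphs that the process can reach; see the lemmas
  \<open>pmf_attachment\<close>, \<open>pa_round_state\<close> and \<open>pa_process_state\<close> below.\<close>

definition attachment_weight ::
  "nat \<Rightarrow> (nat \<Rightarrow> real) \<Rightarrow> nat \<Rightarrow> nat \<Rightarrow> nat mgraph \<Rightarrow> nat \<Rightarrow> real" where
  "attachment_weight m \<delta> t i g v =
     (if v \<in> {0..t - 1}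
      then (real (deg g v) + \<delta> t) /
           (2 * real m * (real t - 1) + \<delta> t * real t + (real i - 1))
      else 0)"

definition attachment ::
  "nat \<Rightarrow> (nat \<Rightarrow> real) \<Rightarrow> nat \<Rightarrow> nat \<Rightarrow> nat mgraph \<Rightarrow> nat pmf" where
  "attachment m \<delta> t i g = embed_pmf (attachment_weight m \<delta> t i g)"

text \<open>\<open>pa_round m \<delta> t i\<close> prolongs a path ending in \<open>G\<^bsub>t-1,m\<^esub>\<close> by \<open>G\<^bsub>t,0\<^esub>, \<dots>, G\<^bsub>t,i\<^esub>\<close>.\<close>

primrec pa_round :: "nat \<Rightarrow> (nat \<Rightarrow> real) \<Rightarrow> nat \<Rightarrow> nat \<Rightarrow> path \<Rightarrow> path pmf" where
  "pa_round m \<delta> t 0 p = return_pmf (add_vertex t (hd p) # p)"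
| "pa_round m \<delta> t (Suc i) p =
     pa_round m \<delta> t i p \<bind> (\<lambda>q.
       map_pmf (\<lambda>v. add_edge t v (hd q) # q) (attachment m \<delta> t (Suc i) (hd q)))"

text \<open>The law of the process up to time \<open>n \<ge> 1\<close>; the value at \<open>0\<close> is irrelevant.\<close>

fun pa_process :: "nat \<Rightarrow> (nat \<Rightarrow> real) \<Rightarrow> nat \<Rightarrow> path pmf" where
  "pa_process m \<delta> 0 = return_pmf []"
| "pa_process m \<delta> (Suc 0) = return_pmf (map initial_graph (rev [0..<Suc m]))"
| "pa_process m \<delta> (Suc (Suc n)) = pa_process m \<delta> (Suc n) \<bind> pa_round m \<delta> (Suc (Suc n)) m"

text \<open>On paths distributed according to \<open>pa_process m \<delta> n\<close>, this is \<open>G\<^sub>n\<close>.\<close>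

definition final_graph :: "path \<Rightarrow> nat mgraph" where
  "final_graph p = hd p"

text \<open>The sigma-algebra on sample points generated by the structure of \<open>G\<^sub>n\<close>.\<close>

definition structure_algebra :: "path measure" where
  "structure_algebra =
     vimage_algebra UNIV (\<lambda>p. graph_structure (final_graph p)) (count_space UNIV)"

definition P0 :: "nat \<Rightarrow> real \<Rightarrow> nat \<Rightarrow> path pmf" where
  "P0 m \<delta>0 n = pa_process m (\<lambda>t. \<delta>0) n"

definition P1 :: "nat \<Rightarrow> real \<Rightarrow> real \<Rightarrow> (nat \<Rightarrow> nat) \<Rightarrow> nat \<Rightarrow> path pmf" where
  "P1 m \<delta>0 \<delta>1 \<tau> n =
     pa_process m (\<lambda>t. \<delta>0 * of_bool (t \<le> \<tau> n) + \<delta>1 * of_bool (t > \<tau> n)) n"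


text \<open>Invariants of \<open>G\<^bsub>t,i\<^esub>\<close>, from which it follows that the attachment weights sum to one.\<close>

definition pa_state :: "nat \<Rightarrow> nat \<Rightarrow> nat \<Rightarrow> nat mgraph \<Rightarrow> bool" where
  "pa_state m t i g \<longleftrightarrow> labeled_graph g \<and> verts g = {0..t} \<and>
     size (edges g) = m * (t - 1) + i \<and> deg g t = i \<and> (\<forall>v<t. m \<le> deg g v)"

lemma deg_add_edge:
  "deg (add_edge u v g) w = deg g w + of_bool (w = u) + of_bool (w = v)"
  by (auto simp: deg_def in_deg_def out_deg_def add_edge_def)

lemma deg_add_vertex [simp]: "deg (add_vertex u g) w = deg g w"
  by (simp add: deg_def in_deg_def out_deg_def add_vertex_def)

lemma sum_deg:
  assumes "labeled_graph g"
  shows "(\<Sum>v\<in>verts g. deg g v) = 2 * size (edges g)"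
proof -
  have fin: "finite (verts g)" using assms by (simp add: labeled_graph_def)
  have "E \<subseteq># edges g \<Longrightarrow>
    (\<Sum>v\<in>verts g. size {#e \<in># E. snd e = v#} + size {#e \<in># E. fst e = v#}) = 2 * size E" for E
  proof (induction E)
    case empty
    then show ?case by simp
  next
    case (add e E)
    have e: "fst e \<in> verts g" "snd e \<in> verts g"
      using add.prems assms mset_subset_eqD[OF add.prems, of e]
      by (cases e; auto simp: labeled_graph_def)+
    have IH: "(\<Sum>v\<in>verts g. size {#e \<in># E. snd e = v#} + size {#e \<in># E. fst e = v#}) = 2 * size E"
      using add.IH add.prems subset_mset.order_trans[of E "add_mset e E" "edges g"] by simp
    have "(\<Sum>v\<in>verts g. size {#e' \<in># add_mset e E. snd e' = v#} + size {#e' \<in># add_mset e E. fst e' = v#})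
        = (\<Sum>v\<in>verts g. (size {#e \<in># E. snd e = v#} + size {#e \<in># E. fst e = v#})
             + ((if snd e = v then 1 else 0) + (if fst e = v then 1 else 0)))"
      by (intro sum.cong) auto
    also have "\<dots> = 2 * size E + 2"
      using fin e by (simp only: sum.distrib IH[unfolded sum.distrib] sum.delta) simp
    finally show ?case by simp
  qed
  from this[of "edges g"] show ?thesis
    by (simp add: deg_def in_deg_def out_deg_def)
qed

lemma pmf_attachment:
  assumes m: "m \<ge> 1" and \<delta>: "\<delta> t > - real m" and t: "t \<ge> 2" and st: "pa_state m t i g"
  shows "pmf (attachment m \<delta> t (Suc i) g) v = attachment_weight m \<delta> t (Suc i) g v"
proof -
  define D where "D = 2 * real m * (real t - 1) + \<delta> t * real t + real i"
  have ge: "real m \<le> real (deg g v)" if "v < t" for v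
    using st that by (auto simp: pa_state_def)
  have ivl: "{0..t - 1} = {..<t}" using t by auto
  have "{0..t} = insert t {..<t}" by auto
  then have "(\<Sum>v<t. deg g v) + i = 2 * (m * (t - 1) + i)"
    using sum_deg[of g] st by (auto simp: pa_state_def)
  then have "real ((\<Sum>v<t. deg g v) + i) = real (2 * (m * (t - 1) + i))" by (rule arg_cong)
  then have "(\<Sum>v<t. real (deg g v)) + real i = 2 * (real m * (real t - 1) + real i)"
    using t unfolding of_nat_add of_nat_mult of_nat_sum by (simp add: of_nat_diff)
  then have s: "(\<Sum>v<t. real (deg g v) + \<delta> t) = D"
    by (simp add: D_def sum.distrib algebra_simps)
  have pos: "D > 0" unfolding s[symmetric]
  proof (rule sum_pos)
    show "{..<t} \<noteq> {}" using t by (auto simp: lessThan_empty_iff)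
    show "0 < real (deg g v) + \<delta> t" if "v \<in> {..<t}" for v
      using ge[of v] \<delta> that by simp
  qed simp
  have w: "attachment_weight m \<delta> t (Suc i) g v = (if v < t then (real (deg g v) + \<delta> t) / D else 0)" for v
    using t by (auto simp: attachment_weight_def D_def)
  have nn: "attachment_weight m \<delta> t (Suc i) g v \<ge> 0" for v
    using ge[of v] \<delta> pos by (auto simp: w intro!: divide_nonneg_pos)
  have "(\<integral>\<^sup>+ v. ennreal (attachment_weight m \<delta> t (Suc i) g v) \<partial>count_space UNIV)
      = (\<Sum>v<t. ennreal (attachment_weight m \<delta> t (Suc i) g v))"
    by (intro nn_integral_count_space'[where A = "{..<t}"]) (auto simp: w)
  also have "\<dots> = ennreal (\<Sum>v<t. attachment_weight m \<delta> t (Suc i) g v)"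
    using nn by (intro sum_ennreal) auto
  also have "(\<Sum>v<t. attachment_weight m \<delta> t (Suc i) g v) = 1"
    using s pos by (simp add: w flip: sum_divide_distrib)
  finally show ?thesis
    unfolding attachment_def by (intro pmf_embed_pmf nn) auto
qed

lemma pa_round_state:
  assumes "m \<ge> 1" "\<delta> t > - real m" "t \<ge> 2" "pa_state m (t - 1) m (hd p)"
    and "q \<in> set_pmf (pa_round m \<delta> t i p)"
  shows "pa_state m t i (hd q)"
  using assms(5)
proof (induction i arbitrary: q)
  case 0
  have vs: "verts (hd p) = {0..t - 1}" and lg: "labeled_graph (hd p)"
    and sz: "size (edges (hd p)) = m * (t - 1 - 1) + m"
    and dt: "deg (hd p) (t - 1) = m" and dv: "\<forall>v<t - 1. m \<le> deg (hd p) v"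
    using assms(4) by (auto simp: pa_state_def)
  have e: "u \<in> {0..t - 1} \<and> v \<in> {0..t - 1} \<and> u \<noteq> v" if "(u, v) \<in># edges (hd p)" for u v
    using lg that vs by (auto simp: labeled_graph_def)
  have "deg (hd p) t = 0"
  proof -
    have "{#x \<in># edges (hd p). snd x = t#} = {#}" "{#x \<in># edges (hd p). fst x = t#} = {#}"
      using e assms(3) by (force simp: multiset_eq_iff not_in_iff)+
    then show ?thesis by (simp add: deg_def in_deg_def out_deg_def)
  qed
  moreover have "m * (t - 1 - 1) + m = m * (t - 1)"
    using assms(3) by (cases t; cases "t - 1") auto
  moreover have "\<forall>v<t. m \<le> deg (hd p) v"
  proof (intro allI impI)
    fix v assume "v < t"
    then consider "v < t - 1" | "v = t - 1" by linarith
    then show "m \<le> deg (hd p) v" using dt dv by cases auto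
  qed
  moreover have "labeled_graph (add_vertex t (hd p))"
    using lg unfolding labeled_graph_def add_vertex_def case_prod_unfold by simp
  moreover have "insert t {0..t - 1} = {0..t}" using assms(3) by auto
  then have "verts (add_vertex t (hd p)) = {0..t}"
    unfolding add_vertex_def by (simp add: vs)
  moreover have "edges (add_vertex t (hd p)) = edges (hd p)"
    by (simp add: add_vertex_def)
  ultimately show ?case using 0 sz by (simp add: pa_state_def)
next
  case (Suc i)
  then obtain p' v where p': "p' \<in> set_pmf (pa_round m \<delta> t i p)"
    and v: "v \<in> set_pmf (attachment m \<delta> t (Suc i) (hd p'))"
    and q: "q = add_edge t v (hd p') # p'"
    by auto
  have st: "pa_state m t i (hd p')" using Suc.IH p' by simp
  have "attachment_weight m \<delta> t (Suc i) (hd p') v \<noteq> 0"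
    using v pmf_attachment[of m \<delta> t i "hd p'" v] assms(1-3) st
    by (simp add: set_pmf_iff)
  then have "v < t" using assms(3) by (auto simp: attachment_weight_def split: if_splits)
  moreover have "labeled_graph (add_edge t v (hd p'))"
    using st \<open>v < t\<close> by (auto simp: labeled_graph_def add_edge_def pa_state_def)
  moreover have "verts (add_edge t v (hd p')) = verts (hd p')"
    "size (edges (add_edge t v (hd p'))) = Suc (size (edges (hd p')))"
    by (simp_all add: add_edge_def)
  ultimately show ?case using st
    by (auto simp: q pa_state_def deg_add_edge trans_le_add1)
qed

lemma initial_graph_state: "pa_state m 1 m (initial_graph m)"
proof -
  have "labeled_graph (initial_graph i) \<and> verts (initial_graph i) = {0..1} \<and>
      size (edges (initial_graph i)) = i \<and> deg (initial_graph i) 1 = i \<and> deg (initial_graph i) 0 = i" for i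
  proof (induction i)
    case 0
    then show ?case by (auto simp: labeled_graph_def deg_def in_deg_def out_deg_def)
  next
    case (Suc i)
    have "labeled_graph (add_edge 1 0 (initial_graph i))"
      using Suc.IH by (auto simp: labeled_graph_def add_edge_def)
    moreover have "verts (add_edge 1 0 (initial_graph i)) = {0..1}"
      "size (edges (add_edge 1 0 (initial_graph i))) = Suc i"
      using Suc.IH by (simp_all add: add_edge_def)
    ultimately show ?case using Suc.IH by (simp add: deg_add_edge)
  qed
  from this[of m] show ?thesis by (auto simp: pa_state_def less_Suc_eq)
qed

lemma pa_process_state:
  assumes "m \<ge> 1" "\<And>t. \<delta> t > - real m" "n \<ge> 1" "p \<in> set_pmf (pa_process m \<delta> n)"
  shows "pa_state m n m (final_graph p)"
  using assms(3,4)
proof (induction n arbitrary: p rule: nat_induct_at_least)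
  case base
  have "rev [0..<Suc m] = m # rev [0..<m]" by simp
  then have "final_graph p = initial_graph m"
    using base by (simp add: final_graph_def)
  then show ?case using initial_graph_state[of m] by simp
next
  case (Suc n)
  then obtain k where k: "n = Suc k" by (cases n) auto
  from Suc.prems obtain q where q: "q \<in> set_pmf (pa_process m \<delta> n)"
    and p: "p \<in> set_pmf (pa_round m \<delta> (Suc n) m q)"
    by (auto simp: k)
  show ?case
    using pa_round_state[of m \<delta> "Suc n" q p m] Suc.IH[OF q] assms(1,2) p Suc.hyps
    by (simp add: final_graph_def)
qed

end

theory Submission
  imports Defs "HOL-Combinatorics.Permutations"
begin

text \<open>
A late change cannot be detected from the structure because the structure does not reveal when a
vertex arrived: the \<open>k = n - \<tau> n\<close> rounds run with the changed parameter \<open>\<delta>1\<close> could as well have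
taken place at other times, and once they are hidden among sufficiently many unchanged rounds they
leave no trace.

To make this precise, split the last \<open>k\<^sup>2\<close> rounds into \<open>k\<close> blocks of length \<open>k\<close>, and consider the
process in which each block contains exactly one round with parameter \<open>\<delta>1\<close>, at an independent
uniform position. Two facts carry the proof.

First, this randomized process is dominated by the unchanged one. The likelihood ratio of a single
round is bounded and has conditional mean 1, so different rounds are uncorrelated, and the density
of a block, an average of \<open>k\<close> such ratios, has second moment \<open>1 + O(1 / k)\<close>. The product over \<open>k\<close>
blocks has a bounded second moment, and by Cauchy-Schwarz the squared probability of an event in
the randomized process is at most a constant times its probability under \<open>P0\<close>
(\<open>spikes_second_moment\<close>).

Secondly, the structures of the randomized process and of \<open>P1\<close> are close in law. Exchanging the
parameters of two consecutive rounds at time \<open>t\<close> changes the law of the structure by \<open>O(1 / t)\<close>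
(\<open>grow_swap\<close>): up to such an error the \<open>2 m\<close> targets in these rounds are independent, chosen
according to the degrees before the two rounds, and for independent targets the exchange amounts
to exchanging the names of the two new vertices. Moving \<open>k\<close> changed rounds over at most \<open>k\<^sup>2\<close> places
each to the end costs \<open>O(k\<^sup>3 / n)\<close> (\<open>grow_gather\<close>), which tends to 0 exactly if \<open>k = o(n\<^sup>1\<^sup>/\<^sup>3)\<close>.
\<close>

section \<open>Minorization of probability mass functions\<close>

text \<open>Laws of graphs are compared through one-sided bounds \<open>p \<ge> c q\<close>. They multiply along Markov
kernels, so a bound for one edge at once gives one for a whole round. With \<open>c\<close> close to 1 such a
bound says that the laws are close in total variation; with any \<open>c > 0\<close> it says that \<open>q\<close> has a
bounded density with respect to \<open>p\<close>. Both uses occur below. The definition is by integrals, since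
this is the form in which the bound passes through a bind.\<close>

definition minorizes :: "real \<Rightarrow> 'a pmf \<Rightarrow> 'a pmf \<Rightarrow> bool" where
  "minorizes c q p \<longleftrightarrow>
     (\<forall>f. ennreal c * (\<integral>\<^sup>+x. f x \<partial>measure_pmf q) \<le> (\<integral>\<^sup>+x. f x \<partial>measure_pmf p))"

lemma minorizesD:
  "minorizes c q p \<Longrightarrow> ennreal c * (\<integral>\<^sup>+x. f x \<partial>measure_pmf q) \<le> (\<integral>\<^sup>+x. f x \<partial>measure_pmf p)"
  by (simp add: minorizes_def)

lemma minorizes_pmfI:
  assumes "c \<ge> 0" "\<And>x. c * pmf q x \<le> pmf p x"
  shows "minorizes c q p"
  unfolding minorizes_def nn_integral_measure_pmf
proof
  fix f :: "'a \<Rightarrow> ennreal"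
  have "ennreal c * (\<integral>\<^sup>+x. ennreal (pmf q x) * f x \<partial>count_space UNIV) =
      (\<integral>\<^sup>+x. ennreal c * (ennreal (pmf q x) * f x) \<partial>count_space UNIV)"
    by (simp add: nn_integral_cmult)
  also have "\<dots> \<le> (\<integral>\<^sup>+x. ennreal (pmf p x) * f x \<partial>count_space UNIV)"
    using assms
    by (intro nn_integral_mono)
       (auto simp flip: mult.assoc ennreal_mult intro!: mult_right_mono ennreal_leI)
  finally show "ennreal c * (\<integral>\<^sup>+x. ennreal (pmf q x) * f x \<partial>count_space UNIV) \<le> \<dots>" .
qed

lemma minorizes_pmfD:
  assumes "minorizes c q p" "c \<ge> 0"
  shows "c * pmf q x \<le> pmf p x"
proof -
  have "ennreal c * ennreal (pmf q x) \<le> ennreal (pmf p x)"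
    using minorizesD[OF assms(1), of "indicator {x}"] by (simp add: emeasure_pmf_single)
  then show ?thesis
    using assms(2) by (simp flip: ennreal_mult)
qed

lemma minorizes_refl: "minorizes 1 p p"
  by (simp add: minorizes_def)

lemma minorizes_map: "minorizes c q p \<Longrightarrow> minorizes c (map_pmf g q) (map_pmf g p)"
  by (auto simp: minorizes_def)

lemma minorizes_bind:
  assumes "minorizes c q p" "c' \<ge> 0"
    and "\<And>x. x \<in> set_pmf p \<Longrightarrow> minorizes c' (L x) (K x)"
  shows "minorizes (c * c') (q \<bind> L) (p \<bind> K)"
  unfolding minorizes_def
proof
  fix f :: "'b \<Rightarrow> ennreal"
  have "ennreal (c * c') * (\<integral>\<^sup>+x. f x \<partial>measure_pmf (q \<bind> L)) =
      ennreal c' * (ennreal c * (\<integral>\<^sup>+x. \<integral>\<^sup>+y. f y \<partial>measure_pmf (L x) \<partial>measure_pmf q))"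
    using assms(2) by (simp add: ennreal_mult'' mult_ac)
  also have "\<dots> \<le> ennreal c' * (\<integral>\<^sup>+x. \<integral>\<^sup>+y. f y \<partial>measure_pmf (L x) \<partial>measure_pmf p)"
    by (intro mult_left_mono minorizesD assms(1)) simp
  also have "\<dots> = (\<integral>\<^sup>+x. ennreal c' * (\<integral>\<^sup>+y. f y \<partial>measure_pmf (L x)) \<partial>measure_pmf p)"
    by (simp add: nn_integral_cmult)
  also have "\<dots> \<le> (\<integral>\<^sup>+x. (\<integral>\<^sup>+y. f y \<partial>measure_pmf (K x)) \<partial>measure_pmf p)"
    by (intro nn_integral_mono_AE) (auto simp: AE_measure_pmf_iff intro!: minorizesD assms(3))
  finally show "ennreal (c * c') * (\<integral>\<^sup>+x. f x \<partial>measure_pmf (q \<bind> L)) \<le>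
      (\<integral>\<^sup>+x. f x \<partial>measure_pmf (p \<bind> K))" by simp
qed

text \<open>Writing the constant as \<open>exp (- e)\<close> turns products of constants into sums of errors, and
\<open>exp (- e) \<ge> 1 - e\<close> converts the minorization into an additive error.\<close>

lemma minorizes_integral_le:
  assumes "minorizes (exp (- e)) q p" "e \<ge> 0" "\<And>x. f x \<le> 1"
  shows "(\<integral>\<^sup>+x. f x \<partial>measure_pmf q) \<le> (\<integral>\<^sup>+x. f x \<partial>measure_pmf p) + ennreal e"
proof -
  let ?q = "\<integral>\<^sup>+x. f x \<partial>measure_pmf q"
  have q1: "?q \<le> 1"
    using nn_integral_mono[of "measure_pmf q" f "\<lambda>_. 1"] assms(3) by simp
  have "1 \<le> ennreal (exp (- e)) + ennreal e"
    using assms(2) exp_ge_add_one_self[of "- e"] by (simp flip: ennreal_plus)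
  then have "?q \<le> (ennreal (exp (- e)) + ennreal e) * ?q"
    by (metis mult_1 mult_right_mono zero_le)
  also have "\<dots> = ennreal (exp (- e)) * ?q + ennreal e * ?q"
    by (rule distrib_right)
  also have "\<dots> \<le> (\<integral>\<^sup>+x. f x \<partial>measure_pmf p) + ennreal e * 1"
    by (intro add_mono minorizesD assms(1) mult_left_mono q1) auto
  finally show ?thesis by simp
qed

text \<open>The reverse estimate comes from the previous one applied to \<open>1 - f\<close>: a probability that is too
large on one event is too small on the complement.\<close>

lemma minorizes_integral_ge:
  assumes "minorizes (exp (- e)) q p" "e \<ge> 0" "\<And>x. f x \<le> 1"
  shows "(\<integral>\<^sup>+x. f x \<partial>measure_pmf p) \<le> (\<integral>\<^sup>+x. f x \<partial>measure_pmf q) + ennreal e"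
proof -
  have compl: "(\<integral>\<^sup>+x. f x \<partial>measure_pmf r) + (\<integral>\<^sup>+x. 1 - f x \<partial>measure_pmf r) = 1" for r
  proof -
    have "(\<integral>\<^sup>+x. f x + (1 - f x) \<partial>measure_pmf r) = (\<integral>\<^sup>+x. 1 \<partial>measure_pmf r)"
      by (intro nn_integral_cong) (simp add: assms(3) add_diff_inverse_ennreal)
    then show ?thesis by (simp add: nn_integral_add)
  qed
  let ?P = "\<integral>\<^sup>+x. f x \<partial>measure_pmf p" and ?Q = "\<integral>\<^sup>+x. f x \<partial>measure_pmf q"
  let ?P' = "\<integral>\<^sup>+x. 1 - f x \<partial>measure_pmf p" and ?Q' = "\<integral>\<^sup>+x. 1 - f x \<partial>measure_pmf q"
  have le: "?Q' \<le> ?P' + ennreal e"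
    by (intro minorizes_integral_le assms) (auto simp: diff_le_self_ennreal)
  have "?P + ?P' = ?Q + ?Q'" by (simp add: compl)
  also have "\<dots> \<le> (?Q + ennreal e) + ?P'"
    using add_left_mono[OF le, of ?Q] by (simp add: ac_simps)
  finally have "?P + ?P' \<le> (?Q + ennreal e) + ?P'" .
  moreover have "?P' \<noteq> top"
    using compl[of p] by (metis add_top_right_ennreal ennreal_one_neq_top infinity_ennreal_def ennreal_add_eq_top)
  ultimately show ?thesis
    by (metis add.commute ennreal_add_left_cancel_le infinity_ennreal_def)
qed

section \<open>The graph process without its history\<close>

text \<open>Events about the final graph do not see the trajectory, so the path space can be traded for a
Markov chain on graphs. The parameters of successive rounds form a word, on which rearranging the
parameter function becomes list surgery: \<open>grow m ds t g\<close> runs one round for each letter of \<open>ds\<close>,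
started from \<open>g\<close> at time \<open>t\<close>.\<close>

primrec edge_steps :: "nat \<Rightarrow> real \<Rightarrow> nat \<Rightarrow> nat \<Rightarrow> nat mgraph \<Rightarrow> nat mgraph pmf" where
  "edge_steps m d t 0 g = return_pmf (add_vertex t g)"
| "edge_steps m d t (Suc i) g =
     edge_steps m d t i g \<bind> (\<lambda>h. map_pmf (\<lambda>v. add_edge t v h) (attachment m (\<lambda>_. d) t (Suc i) h))"

primrec grow :: "nat \<Rightarrow> real list \<Rightarrow> nat \<Rightarrow> nat mgraph \<Rightarrow> nat mgraph pmf" where
  "grow m [] t g = return_pmf g"
| "grow m (d # ds) t g = edge_steps m d (Suc t) m g \<bind> grow m ds (Suc t)"

lemma grow_append: "grow m (us @ vs) t g = grow m us t g \<bind> grow m vs (t + length us)"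
  by (induction us arbitrary: t g) (auto simp: bind_return_pmf bind_assoc_pmf intro!: bind_pmf_cong)

lemma attachment_cong: "\<delta> t = \<delta>' t \<Longrightarrow> attachment m \<delta> t i g = attachment m \<delta>' t i g"
  unfolding attachment_def by (intro arg_cong[of _ _ embed_pmf]) (simp add: attachment_weight_def fun_eq_iff)

lemma map_hd_pa_round: "map_pmf hd (pa_round m \<delta> t i p) = edge_steps m (\<delta> t) t i (hd p)"
proof (induction i)
  case (Suc i)
  have "map_pmf hd (pa_round m \<delta> t (Suc i) p) =
      map_pmf hd (pa_round m \<delta> t i p) \<bind>
        (\<lambda>h. map_pmf (\<lambda>v. add_edge t v h) (attachment m (\<lambda>_. \<delta> t) t (Suc i) h))"
    by (simp add: map_bind_pmf bind_map_pmf pmf.map_comp o_def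
        attachment_cong[where \<delta> = "\<delta>" and \<delta>' = "\<lambda>_. \<delta> t" and t = t])
  then show ?case using Suc.IH by simp
qed simp

lemma map_hd_pa_process:
  assumes "n \<ge> 1"
  shows "map_pmf hd (pa_process m \<delta> n) = grow m (map \<delta> [2..<Suc n]) 1 (initial_graph m)"
  using assms
proof (induction n rule: nat_induct_at_least)
  case base
  \<comment> \<open>The path lists the newest graph first, so its head is the last initial graph.\<close>
  have "rev [0..<Suc m] = m # rev [0..<m]" by simp
  then show ?case by (simp del: upt_Suc)
next
  case (Suc n)
  then obtain k where k: "n = Suc k" by (cases n) auto
  have "[2..<Suc (Suc n)] = [2..<Suc n] @ [Suc n]" using Suc.hyps by simp
  moreover have "map_pmf hd (pa_process m \<delta> (Suc n)) =
      map_pmf hd (pa_process m \<delta> n) \<bind> edge_steps m (\<delta> (Suc n)) (Suc n) m"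
    by (simp add: k map_bind_pmf bind_map_pmf map_hd_pa_round)
  moreover have "grow m [d] n = edge_steps m d (Suc n) m" for d
  proof
    have "grow m [] (Suc n) = return_pmf" by (rule ext) simp
    then show "grow m [d] n g = edge_steps m d (Suc n) m g" for g
      by (simp add: bind_return_pmf')
  qed
  ultimately show ?case
    using Suc k by (simp add: grow_append del: upt_Suc grow.simps)
qed

lemma pa_state_add_edge:
  assumes "pa_state m t i g" "v < t"
  shows "pa_state m t (Suc i) (add_edge t v g)"
proof -
  have "labeled_graph (add_edge t v g)"
    using assms by (auto simp: labeled_graph_def add_edge_def pa_state_def)
  moreover have "verts (add_edge t v g) = verts g"
    "size (edges (add_edge t v g)) = Suc (size (edges g))"
    by (simp_all add: add_edge_def)
  ultimately show ?thesis using assms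
    by (auto simp: pa_state_def deg_add_edge trans_le_add1)
qed

lemma pa_state_edge_steps:
  assumes "m \<ge> 1" "d > - real m" "t \<ge> 1" "pa_state m t m g" "h \<in> set_pmf (edge_steps m d (Suc t) i g)"
  shows "pa_state m (Suc t) i h"
proof -
  have "h \<in> set_pmf (map_pmf hd (pa_round m (\<lambda>_. d) (Suc t) i [g]))"
    using assms(5) by (simp only: map_hd_pa_round list.sel)
  then obtain q where "q \<in> set_pmf (pa_round m (\<lambda>_. d) (Suc t) i [g])" "h = hd q" by auto
  then show ?thesis
    using pa_round_state[of m "\<lambda>_. d" "Suc t" "[g]" q i] assms by simp
qed

lemma pa_state_add_vertex:
  assumes "m \<ge> 1" "t \<ge> 1" "pa_state m t m g"
  shows "pa_state m (Suc t) 0 (add_vertex (Suc t) g)"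
  using pa_state_edge_steps[of m 0 t g "add_vertex (Suc t) g" 0] assms by simp

lemma pa_state_grow:
  assumes "m \<ge> 1" "\<forall>d\<in>set ds. d > - real m" "t \<ge> 1" "pa_state m t m g" "h \<in> set_pmf (grow m ds t g)"
  shows "pa_state m (t + length ds) m h"
  using assms(2-)
proof (induction ds arbitrary: t g)
  case (Cons d ds)
  then obtain h' where h': "h' \<in> set_pmf (edge_steps m d (Suc t) m g)" "h \<in> set_pmf (grow m ds (Suc t) h')"
    by auto
  then have "pa_state m (Suc t) m h'"
    using pa_state_edge_steps[of m d t g h' m] assms(1) Cons.prems by simp
  from Cons.IH[OF _ _ this h'(2)] Cons.prems show ?case by simp
qed simp

lemma deg_edge_steps:
  "h \<in> set_pmf (edge_steps m d t i g) \<Longrightarrow> deg g v \<le> deg h v"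
proof (induction i arbitrary: h)
  case (Suc i)
  then obtain h' u where "h' \<in> set_pmf (edge_steps m d t i g)" "h = add_edge t u h'" by auto
  then show ?case using Suc.IH[of h'] by (simp add: deg_add_edge)
qed simp

section \<open>Changing the parameter in one round\<close>

text \<open>The normalizing constant grows linearly in \<open>t\<close>, so a bounded number of new edges perturbs the
attachment probabilities by \<open>O(1 / t)\<close> only.\<close>

lemma total_weight_ge:
  assumes "d > - real m" "t \<ge> 1"
  shows "(real m + d) * (real t + 1) \<le> 2 * real m * real t + d * (real t + 1) + real i"
proof -
  have "real m * 1 \<le> real m * real t" using assms(2) by (intro mult_left_mono) auto
  then show ?thesis by (simp add: algebra_simps)
qed

lemma pmf_attachment_state:
  assumes "m \<ge> 1" "d > - real m" "t \<ge> 1" "pa_state m (Suc t) i h"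
  shows "pmf (attachment m (\<lambda>_. d) (Suc t) (Suc i) h) v =
    (if v \<le> t then (real (deg h v) + d) / (2 * real m * real t + d * (real t + 1) + real i) else 0)"
  using pmf_attachment[of m "\<lambda>_. d" "Suc t" i h v] assms
  by (simp add: attachment_weight_def algebra_simps)

text \<open>A bound for the likelihood ratio of a single attachment under \<open>d'\<close> and \<open>d\<close>: the first factor bounds
\<open>(k + d') / (k + d)\<close> over all degrees \<open>k \<ge> m\<close>, the second one the ratio of the normalizing constants.\<close>

definition comparison :: "nat \<Rightarrow> real \<Rightarrow> real \<Rightarrow> real" where
  "comparison m d d' = (1 + \<bar>d' - d\<bar> / (real m + d)) * (1 + \<bar>d' - d\<bar> / (real m + d'))"

lemma comparison_ge_1:
  assumes "d > - real m" "d' > - real m" shows "comparison m d d' \<ge> 1"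
proof -
  have "1 * 1 \<le> comparison m d d'"
    unfolding comparison_def using assms by (intro mult_mono) auto
  then show ?thesis by simp
qed

lemma attachment_minorizes:
  assumes m: "m \<ge> 1" and d: "d > - real m" and d': "d' > - real m" and t: "t \<ge> 1"
    and st: "pa_state m (Suc t) i h"
  shows "minorizes (1 / comparison m d d') (attachment m (\<lambda>_. d') (Suc t) (Suc i) h)
           (attachment m (\<lambda>_. d) (Suc t) (Suc i) h)"
proof (rule minorizes_pmfI)
  show "1 / comparison m d d' \<ge> 0" using comparison_ge_1[OF d d'] by simp
  fix v
  define D where "D = 2 * real m * real t + d * (real t + 1) + real i"
  define D' where "D' = 2 * real m * real t + d' * (real t + 1) + real i"
  have D: "(real m + d) * (real t + 1) \<le> D" and D': "(real m + d') * (real t + 1) \<le> D'"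
    unfolding D_def D'_def using total_weight_ge d d' t by blast+
  have pos: "D > 0" "D' > 0"
    using D D' d d' by (smt (verit) mult_pos_pos of_nat_0_le_iff)+
  have DD: "D \<le> (1 + \<bar>d' - d\<bar> / (real m + d')) * D'"
  proof -
    have "D - D' = (d - d') * (real t + 1)" by (simp add: D_def D'_def algebra_simps)
    also have "\<dots> \<le> \<bar>d' - d\<bar> * (real t + 1)" by (intro mult_right_mono) auto
    also have "\<dots> = \<bar>d' - d\<bar> / (real m + d') * ((real m + d') * (real t + 1))"
      using d' by simp
    also have "\<dots> \<le> \<bar>d' - d\<bar> / (real m + d') * D'"
      using d' D' by (intro mult_left_mono) auto
    finally show ?thesis by (simp add: algebra_simps)
  qed
  show "1 / comparison m d d' * pmf (attachment m (\<lambda>_. d') (Suc t) (Suc i) h) v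
      \<le> pmf (attachment m (\<lambda>_. d) (Suc t) (Suc i) h) v"
  proof (cases "v \<le> t")
    case True
    then have ge: "real m \<le> real (deg h v)" using st by (auto simp: pa_state_def)
    let ?x = "1 + \<bar>d' - d\<bar> / (real m + d)" and ?y = "1 + \<bar>d' - d\<bar> / (real m + d')"
    have "real (deg h v) + d' \<le> (real (deg h v) + d) + \<bar>d' - d\<bar> / (real m + d) * (real m + d)"
      using d by simp
    also have "\<dots> \<le> (real (deg h v) + d) + \<bar>d' - d\<bar> / (real m + d) * (real (deg h v) + d)"
      using ge d by (intro add_left_mono mult_left_mono) auto
    finally have w: "real (deg h v) + d' \<le> ?x * (real (deg h v) + d)" by (simp add: algebra_simps)
    have "(real (deg h v) + d') * D \<le> (?x * (real (deg h v) + d)) * (?y * D')"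
      using w DD ge d d' pos by (intro mult_mono) (auto intro!: mult_nonneg_nonneg)
    then have "(real (deg h v) + d') * D \<le> comparison m d d' * ((real (deg h v) + d) * D')"
      by (simp add: comparison_def ac_simps)
    then have "1 / comparison m d d' * ((real (deg h v) + d') / D') \<le> (real (deg h v) + d) / D"
      using pos comparison_ge_1[OF d d'] by (simp add: divide_simps mult_ac)
    then show ?thesis
      using True st m d d' t by (simp only: pmf_attachment_state D_def D'_def if_True)
  next
    case False
    then show ?thesis using st m d d' t by (simp add: pmf_attachment_state)
  qed
qed

lemma edge_steps_minorizes:
  assumes "m \<ge> 1" "d > - real m" "d' > - real m" "t \<ge> 1" "pa_state m t m g"
  shows "minorizes ((1 / comparison m d d') ^ i) (edge_steps m d' (Suc t) i g) (edge_steps m d (Suc t) i g)"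
proof (induction i)
  case 0
  then show ?case by (simp add: minorizes_refl)
next
  case (Suc i)
  have "minorizes ((1 / comparison m d d') ^ i * (1 / comparison m d d'))
      (edge_steps m d' (Suc t) (Suc i) g) (edge_steps m d (Suc t) (Suc i) g)"
    unfolding edge_steps.simps
    using assms comparison_ge_1[of m d d']
    by (intro minorizes_bind Suc.IH minorizes_map attachment_minorizes pa_state_edge_steps[of m d t g])
       auto
  then show ?case by (simp add: mult.commute)
qed

section \<open>Swapping two consecutive rounds\<close>

text \<open>Consider two consecutive rounds, with vertices \<open>t + 1\<close> and \<open>t + 2\<close>, as a perturbation of frozen
rounds, in which all \<open>2 m\<close> targets are independent and drawn with the degrees of the graph at time
\<open>t\<close>. A frozen step ignores its own effect on the degrees, which are of total size \<open>t\<close>, and thus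
errs by \<open>O(1 / t)\<close>. In the frozen model, exchanging the two parameters is the same as exchanging
the names of the two new vertices, and structures do not see names.\<close>

definition attach_all :: "'a \<Rightarrow> 'a list \<Rightarrow> 'a mgraph \<Rightarrow> 'a mgraph" where
  "attach_all s xs g = g\<lparr>edges := edges g + mset (map (Pair s) xs)\<rparr>"

definition frozen_steps :: "nat pmf \<Rightarrow> nat \<Rightarrow> nat \<Rightarrow> nat mgraph \<Rightarrow> nat mgraph pmf" where
  "frozen_steps p s i g = map_pmf (\<lambda>xs. attach_all s xs (add_vertex s g)) (replicate_pmf i p)"

lemma frozen_steps_0: "frozen_steps p s 0 g = return_pmf (add_vertex s g)"
  by (simp add: frozen_steps_def attach_all_def)

lemma frozen_steps_Suc:
  "frozen_steps p s (Suc i) g = frozen_steps p s i g \<bind> (\<lambda>h. map_pmf (\<lambda>v. add_edge s v h) p)"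
proof -
  have *: "add_edge s x (attach_all s xs h) = attach_all s (x # xs) h" for x xs h
    by (simp add: add_edge_def attach_all_def)
  show ?thesis
    unfolding frozen_steps_def
    by (simp add: map_bind_pmf bind_map_pmf map_pmf_def bind_return_pmf bind_assoc_pmf *
        bind_commute_pmf[of "replicate_pmf i p" p])
qed

definition frozen :: "nat \<Rightarrow> real \<Rightarrow> nat \<Rightarrow> nat mgraph \<Rightarrow> nat pmf" where
  "frozen m d t g = attachment m (\<lambda>_. d) (Suc t) (Suc 0) (add_vertex (Suc t) g)"

lemma pmf_frozen:
  assumes "m \<ge> 1" "d > - real m" "t \<ge> 1" "pa_state m t m g"
  shows "pmf (frozen m d t g) v =
    (if v \<le> t then (real (deg g v) + d) / (2 * real m * real t + d * (real t + 1)) else 0)"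
  unfolding frozen_def
  using pmf_attachment_state[OF assms(1-3) pa_state_add_vertex[OF assms(1,3,4)], of v] by simp

lemma set_pmf_frozen:
  assumes "m \<ge> 1" "d > - real m" "t \<ge> 1" "pa_state m t m g" "v \<in> set_pmf (frozen m d t g)"
  shows "v \<le> t"
  using assms(5) pmf_frozen[OF assms(1-4), of v] by (auto simp: set_pmf_iff split: if_splits)

text \<open>The total weight grows by at most \<open>3 m + \<bar>d\<bar>\<close> between the freezing time and any of the \<open>2 m\<close>
steps, and it is at least \<open>(m + d) (t + 1)\<close> at the freezing time. Hence \<open>drift m d / (t + 1)\<close> bounds
its relative growth.\<close>

definition drift :: "nat \<Rightarrow> real \<Rightarrow> real" where
  "drift m d = (3 * real m + \<bar>d\<bar>) / (real m + d)"

text \<open>Degrees of old vertices only increase, so the numerator of the true weight dominates the frozen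
one and only the denominators have to be compared. Mass that goes to the new vertex is simply
ignored, which is why a one-sided bound is convenient.\<close>

lemma frozen_minorizes_attachment:
  assumes m: "m \<ge> 1" and d: "d > - real m" and t: "t \<ge> 1" and g: "pa_state m t m g"
    and s: "s = t \<or> s = Suc t" and i: "i < m" and h: "pa_state m (Suc s) i h"
    and deg: "\<And>v. deg g v \<le> deg h v"
  shows "minorizes (exp (- drift m d / (real t + 1))) (frozen m d t g)
           (attachment m (\<lambda>_. d) (Suc s) (Suc i) h)"
proof (rule minorizes_pmfI)
  fix v
  define D where "D = 2 * real m * real t + d * (real t + 1)"
  define D' where "D' = 2 * real m * real s + d * (real s + 1) + real i"
  define x where "x = drift m d / (real t + 1)"
  have D: "(real m + d) * (real t + 1) \<le> D"
    unfolding D_def using total_weight_ge[of m d t 0] d t by simp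
  have D0: "D > 0" using D d by (smt (verit) mult_pos_pos of_nat_0_le_iff)
  have D'0: "D' > 0"
    unfolding D'_def using total_weight_ge[of m d s i] d t s
    by (smt (verit) mult_pos_pos of_nat_0_le_iff le_SucI)
  have x0: "x \<ge> 0" using d by (auto simp: x_def drift_def)
  have "D' - D \<le> 3 * real m + \<bar>d\<bar>"
    using s i by (auto simp: D_def D'_def algebra_simps)
  also have "\<dots> = x * ((real m + d) * (real t + 1))"
    using d by (simp add: x_def drift_def)
  also have "\<dots> \<le> x * D" using D x0 by (intro mult_left_mono)
  finally have "D' \<le> (1 + x) * D" by (simp add: algebra_simps)
  also have "\<dots> \<le> exp x * D" using D0 by (intro mult_right_mono exp_ge_add_one_self) auto
  finally have DD: "exp (- x) * D' \<le> D" by (simp add: exp_minus field_simps)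
  show "exp (- drift m d / (real t + 1)) * pmf (frozen m d t g) v
      \<le> pmf (attachment m (\<lambda>_. d) (Suc s) (Suc i) h) v"
  proof (cases "v \<le> t")
    case True
    then have vs: "v \<le> s" using s by auto
    have "real m \<le> real (deg g v)"
      using g True by (cases "v = t") (auto simp: pa_state_def)
    then have "(real (deg g v) + d) * (exp (- x) * D') \<le> (real (deg h v) + d) * D"
      using DD deg[of v] d D'0 D0 by (intro mult_mono) auto
    then have "exp (- x) * ((real (deg g v) + d) / D) \<le> (real (deg h v) + d) / D'"
      using D0 D'0 by (simp add: field_simps)
    moreover have "s \<ge> 1" using s t by auto
    ultimately show ?thesis
      using True vs m d t g h
      by (simp add: pmf_attachment_state pmf_frozen D_def D'_def x_def)
  next
    case False
    then show ?thesis using m d t g by (simp add: pmf_frozen)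
  qed
qed simp

lemma frozen_steps_minorizes:
  assumes m: "m \<ge> 1" and d: "d > - real m" and t: "t \<ge> 1" and g: "pa_state m t m g"
    and s: "s = t \<or> s = Suc t" and h: "pa_state m s m h"
    and deg: "\<And>v. deg g v \<le> deg h v" and i: "i \<le> m"
  shows "minorizes (exp (- drift m d / (real t + 1)) ^ i) (frozen_steps (frozen m d t g) (Suc s) i h)
           (edge_steps m d (Suc s) i h)"
  using i
proof (induction i)
  case 0
  then show ?case by (simp add: frozen_steps_0 minorizes_refl)
next
  case (Suc i)
  have s1: "s \<ge> 1" using s t by auto
  have "minorizes (exp (- drift m d / (real t + 1)) ^ i * exp (- drift m d / (real t + 1)))
      (frozen_steps (frozen m d t g) (Suc s) (Suc i) h) (edge_steps m d (Suc s) (Suc i) h)"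
    unfolding frozen_steps_Suc edge_steps.simps
  proof (intro minorizes_bind minorizes_map)
    show "minorizes (exp (- drift m d / (real t + 1)) ^ i) (frozen_steps (frozen m d t g) (Suc s) i h)
        (edge_steps m d (Suc s) i h)"
      using Suc by simp
    fix h' assume h': "h' \<in> set_pmf (edge_steps m d (Suc s) i h)"
    show "minorizes (exp (- drift m d / (real t + 1))) (frozen m d t g)
        (attachment m (\<lambda>_. d) (Suc s) (Suc i) h')"
    proof (rule frozen_minorizes_attachment[OF m d t g s])
      show "pa_state m (Suc s) i h'" by (rule pa_state_edge_steps[OF m d s1 h h'])
      show "deg g v \<le> deg h' v" for v
        using deg[of v] deg_edge_steps[OF h', of v] by simp
    qed (use Suc.prems in simp)
  qed simp
  then show ?case by (simp add: mult.commute)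
qed

definition two_rounds :: "nat \<Rightarrow> real \<Rightarrow> real \<Rightarrow> nat \<Rightarrow> nat mgraph \<Rightarrow> nat mgraph pmf" where
  "two_rounds m a b t g = edge_steps m a (Suc t) m g \<bind> edge_steps m b (Suc (Suc t)) m"

definition frozen_rounds :: "nat \<Rightarrow> real \<Rightarrow> real \<Rightarrow> nat \<Rightarrow> nat mgraph \<Rightarrow> nat mgraph pmf" where
  "frozen_rounds m a b t g =
     frozen_steps (frozen m a t g) (Suc t) m g \<bind> frozen_steps (frozen m b t g) (Suc (Suc t)) m"

lemma frozen_rounds_minorizes:
  assumes m: "m \<ge> 1" and a: "a > - real m" and b: "b > - real m" and t: "t \<ge> 1"
    and g: "pa_state m t m g"
  shows "minorizes (exp (- (real m * (drift m a + drift m b) / (real t + 1))))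
           (frozen_rounds m a b t g) (two_rounds m a b t g)"
proof -
  have "minorizes (exp (- drift m a / (real t + 1)) ^ m * exp (- drift m b / (real t + 1)) ^ m)
      (frozen_rounds m a b t g) (two_rounds m a b t g)"
    unfolding frozen_rounds_def two_rounds_def
  proof (rule minorizes_bind)
    fix h assume h: "h \<in> set_pmf (edge_steps m a (Suc t) m g)"
    show "minorizes (exp (- drift m b / (real t + 1)) ^ m)
        (frozen_steps (frozen m b t g) (Suc (Suc t)) m h) (edge_steps m b (Suc (Suc t)) m h)"
      using m b t g pa_state_edge_steps[OF m a t g h] deg_edge_steps[OF h]
      by (intro frozen_steps_minorizes) auto
  next
    show "minorizes (exp (- drift m a / (real t + 1)) ^ m)
        (frozen_steps (frozen m a t g) (Suc t) m g) (edge_steps m a (Suc t) m g)"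
      using m a t g by (intro frozen_steps_minorizes) auto
  qed simp
  also have "exp (- drift m a / (real t + 1)) ^ m * exp (- drift m b / (real t + 1)) ^ m =
      exp (- (real m * (drift m a + drift m b) / (real t + 1)))"
    by (simp only: exp_of_nat_mult[symmetric] exp_add[symmetric])
       (simp add: ring_distribs add_divide_distrib)
  finally show ?thesis .
qed

lemma pa_state_frozen_steps:
  assumes "m \<ge> 1" "s \<ge> 1" "pa_state m s m h" "\<And>v. v \<in> set_pmf p \<Longrightarrow> v \<le> s"
    and "h' \<in> set_pmf (frozen_steps p (Suc s) i h)"
  shows "pa_state m (Suc s) i h'"
  using assms(5)
proof (induction i arbitrary: h')
  case 0
  then show ?case using pa_state_add_vertex[OF assms(1-3)] by (simp add: frozen_steps_0)
next
  case (Suc i)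
  then obtain h'' v where "h'' \<in> set_pmf (frozen_steps p (Suc s) i h)" "v \<in> set_pmf p"
    "h' = add_edge (Suc s) v h''"
    by (auto simp: frozen_steps_Suc)
  then show ?case using Suc.IH[of h''] assms(4)[of v] pa_state_add_edge[of m "Suc s" i h'' v] by simp
qed

text \<open>The results of frozen rounds have to obey the invariants of the process, in either order of the
parameters: only for such graphs is it known that the later rounds commute with exchanging the two
new vertices. A true graph in which \<open>t + 2\<close> has an edge to \<open>t + 1\<close> would violate them after the
exchange, as its last vertex would have a degree above \<open>m\<close>.\<close>

lemma pa_state_frozen_rounds:
  assumes "m \<ge> 1" "a > - real m" "b > - real m" "t \<ge> 1" "pa_state m t m g"
    and "h \<in> set_pmf (frozen_rounds m a b t g)"
  shows "pa_state m (Suc (Suc t)) m h"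
proof -
  from assms(6) obtain h' where h': "h' \<in> set_pmf (frozen_steps (frozen m a t g) (Suc t) m g)"
    and h: "h \<in> set_pmf (frozen_steps (frozen m b t g) (Suc (Suc t)) m h')"
    by (auto simp: frozen_rounds_def)
  have "pa_state m (Suc t) m h'"
    using pa_state_frozen_steps[OF assms(1,4,5) _ h'] set_pmf_frozen[OF assms(1,2,4,5)] by blast
  then show ?thesis
    using pa_state_frozen_steps[OF assms(1) _ _ _ h] set_pmf_frozen[OF assms(1,3,4,5)]
    by (simp add: le_SucI)
qed

section \<open>Relabelling vertices\<close>

definition relabel :: "('a \<Rightarrow> 'b) \<Rightarrow> 'a mgraph \<Rightarrow> 'b mgraph" where
  "relabel \<phi> g = \<lparr>verts = \<phi> ` verts g, edges = image_mset (map_prod \<phi> \<phi>) (edges g)\<rparr>"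

lemma relabel_add_vertex: "relabel \<phi> (add_vertex v g) = add_vertex (\<phi> v) (relabel \<phi> g)"
  by (simp add: relabel_def add_vertex_def)

lemma relabel_add_edge: "relabel \<phi> (add_edge u v g) = add_edge (\<phi> u) (\<phi> v) (relabel \<phi> g)"
  by (simp add: relabel_def add_edge_def)

lemma relabel_attach_all:
  "relabel \<phi> (attach_all s xs g) = attach_all (\<phi> s) (map \<phi> xs) (relabel \<phi> g)"
  by (simp add: relabel_def attach_all_def multiset.map_comp comp_def)

lemma deg_relabel:
  assumes "inj \<phi>"
  shows "deg (relabel \<phi> g) (\<phi> v) = deg g v"
  by (simp add: deg_def in_deg_def out_deg_def relabel_def filter_mset_image_mset inj_eq[OF assms])

lemma mult_relabel:
  assumes "inj \<phi>"
  shows "mult (relabel \<phi> g) (\<phi> u) (\<phi> v) = mult g u v"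
proof -
  have "count (image_mset (map_prod \<phi> \<phi>) E) (\<phi> u, \<phi> v) = count E (u, v)" for E
    by (induction E) (auto simp: inj_eq[OF assms])
  then show ?thesis by (simp add: mult_def relabel_def)
qed

lemma graph_iso_relabel:
  assumes "bij \<phi>"
  shows "graph_iso (relabel \<phi> g) h \<longleftrightarrow> graph_iso g h"
proof
  have inj: "inj \<phi>" using assms by (rule bij_is_inj)
  have \<phi>: "bij_betw \<phi> (verts g) (verts (relabel \<phi> g))"
    using inj by (simp add: bij_betw_def relabel_def inj_on_def)
  {
    assume "graph_iso (relabel \<phi> g) h"
    then obtain \<psi> where \<psi>: "bij_betw \<psi> (verts (relabel \<phi> g)) (verts h)"
      "\<And>u v. u \<in> verts (relabel \<phi> g) \<Longrightarrow> v \<in> verts (relabel \<phi> g) \<Longrightarrow>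
        mult (relabel \<phi> g) u v = mult h (\<psi> u) (\<psi> v)"
      unfolding graph_iso_def by blast
    show "graph_iso g h"
      unfolding graph_iso_def
    proof (intro exI[of _ "\<psi> \<circ> \<phi>"] conjI ballI)
      show "bij_betw (\<psi> \<circ> \<phi>) (verts g) (verts h)"
        using \<phi> \<psi>(1) by (rule bij_betw_trans)
      fix u v assume "u \<in> verts g" "v \<in> verts g"
      then show "mult g u v = mult h ((\<psi> \<circ> \<phi>) u) ((\<psi> \<circ> \<phi>) v)"
        using \<psi>(2)[of "\<phi> u" "\<phi> v"] mult_relabel[OF inj, of g u v] by (simp add: relabel_def)
    qed
  }
  {
    assume "graph_iso g h"
    then obtain \<psi> where \<psi>: "bij_betw \<psi> (verts g) (verts h)"
      "\<And>u v. u \<in> verts g \<Longrightarrow> v \<in> verts g \<Longrightarrow> mult g u v = mult h (\<psi> u) (\<psi> v)"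
      unfolding graph_iso_def by blast
    have inv: "inv \<phi> (\<phi> u) = u" for u using inj by simp
    show "graph_iso (relabel \<phi> g) h"
      unfolding graph_iso_def
    proof (intro exI[of _ "\<psi> \<circ> inv \<phi>"] conjI ballI)
      have "bij_betw (inv \<phi>) (verts (relabel \<phi> g)) (verts g)"
        by (rule bij_betw_byWitness[where f' = \<phi>]) (auto simp: relabel_def inv)
      then show "bij_betw (\<psi> \<circ> inv \<phi>) (verts (relabel \<phi> g)) (verts h)"
        using \<psi>(1) by (rule bij_betw_trans)
      fix u v assume "u \<in> verts (relabel \<phi> g)" "v \<in> verts (relabel \<phi> g)"
      then obtain u' v' where "u' \<in> verts g" "v' \<in> verts g" "u = \<phi> u'" "v = \<phi> v'"
        by (auto simp: relabel_def)
      then show "mult (relabel \<phi> g) u v = mult h ((\<psi> \<circ> inv \<phi>) u) ((\<psi> \<circ> inv \<phi>) v)"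
        using \<psi>(2)[of u' v'] mult_relabel[OF inj, of g u' v'] inv by simp
    qed
  }
qed

lemma graph_structure_relabel: "bij \<phi> \<Longrightarrow> graph_structure (relabel \<phi> g) = graph_structure g"
  by (simp add: graph_structure_def graph_iso_relabel)

text \<open>All targets are at most \<open>t\<close>, so the transposition only moves the two sources. This turns the pair
of target lists drawn with parameters \<open>a, b\<close> into the pair drawn with \<open>b, a\<close>; as the lists are
independent, the order of the draws does not matter.\<close>

lemma relabel_frozen_rounds:
  assumes m: "m \<ge> 1" and a: "a > - real m" and b: "b > - real m" and t: "t \<ge> 1"
    and g: "pa_state m t m g"
  shows "map_pmf (relabel (Transposition.transpose (Suc t) (Suc (Suc t)))) (frozen_rounds m a b t g) =
    frozen_rounds m b a t g"
proof -
  let ?\<phi> = "Transposition.transpose (Suc t) (Suc (Suc t))"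
  let ?G = "\<lambda>xs ys. attach_all (Suc (Suc t)) ys (add_vertex (Suc (Suc t))
      (attach_all (Suc t) xs (add_vertex (Suc t) g)))"
  have phi_fix: "?\<phi> v = v" if "v \<le> t" for v using that by (auto simp: Transposition.transpose_def)
  have lists: "set xs \<subseteq> {..t}" if "xs \<in> set_pmf (replicate_pmf m (frozen m d t g))" "d > - real m" for xs d
    using that set_pmf_frozen[OF m that(2) t g] by (auto simp: set_replicate_pmf)
  have gfix: "relabel ?\<phi> g = g"
  proof -
    have v: "verts g = {0..t}" and e: "\<And>u w. (u, w) \<in># edges g \<Longrightarrow> u \<le> t \<and> w \<le> t"
      using g by (auto simp: pa_state_def labeled_graph_def)
    have "image_mset (map_prod ?\<phi> ?\<phi>) (edges g) = image_mset (\<lambda>x. x) (edges g)"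
      by (intro image_mset_cong) (auto simp: phi_fix dest!: e)
    moreover have "?\<phi> ` verts g = verts g" using phi_fix by (force simp: v image_def)
    ultimately show ?thesis by (simp add: relabel_def)
  qed
  have swap: "relabel ?\<phi> (?G xs ys) = ?G ys xs" if "set xs \<subseteq> {..t}" "set ys \<subseteq> {..t}" for xs ys
  proof -
    have "map ?\<phi> xs = xs" "map ?\<phi> ys = ys" using that phi_fix by (auto intro!: map_idI)
    then show ?thesis
      by (simp add: relabel_attach_all relabel_add_vertex gfix)
         (simp add: attach_all_def add_vertex_def insert_commute)
  qed
  have fr: "frozen_rounds m a b t g = replicate_pmf m (frozen m a t g) \<bind> (\<lambda>xs.
      replicate_pmf m (frozen m b t g) \<bind> (\<lambda>ys. return_pmf (?G xs ys)))" for a b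
    by (simp add: frozen_rounds_def frozen_steps_def map_pmf_def bind_assoc_pmf bind_return_pmf)
  have "map_pmf (relabel ?\<phi>) (frozen_rounds m a b t g) = replicate_pmf m (frozen m a t g) \<bind> (\<lambda>xs.
      replicate_pmf m (frozen m b t g) \<bind> (\<lambda>ys. return_pmf (?G ys xs)))"
    unfolding fr map_bind_pmf map_return_pmf
    using lists a b by (intro bind_pmf_cong refl) (simp add: swap)
  also have "\<dots> = frozen_rounds m b a t g"
    unfolding fr by (rule bind_commute_pmf)
  finally show ?thesis .
qed

text \<open>The weights depend on the graph only through degrees, so attachment commutes with permutations of
the existing vertices. Both graphs have to satisfy the invariants, because only then the weights
are known to define a probability mass function.\<close>

lemma attachment_relabel:
  assumes m: "m \<ge> 1" and d: "d > - real m" and s: "s \<ge> 1" and perm: "\<phi> permutes {..s}"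
    and st: "pa_state m (Suc s) i h" "pa_state m (Suc s) i (relabel \<phi> h)"
  shows "attachment m (\<lambda>_. d) (Suc s) (Suc i) (relabel \<phi> h) =
    map_pmf \<phi> (attachment m (\<lambda>_. d) (Suc s) (Suc i) h)"
proof (rule pmf_eqI)
  fix v
  have bij: "bij \<phi>" using perm by (rule permutes_bij)
  then obtain u where v: "v = \<phi> u" by (metis bij_pointE)
  have "\<phi> u \<le> s \<longleftrightarrow> u \<le> s" using permutes_in_image[OF perm, of u] by simp
  then show "pmf (attachment m (\<lambda>_. d) (Suc s) (Suc i) (relabel \<phi> h)) v =
      pmf (map_pmf \<phi> (attachment m (\<lambda>_. d) (Suc s) (Suc i) h)) v"
    using m d s st bij
    by (simp add: v pmf_map_inj' bij_is_inj pmf_attachment_state deg_relabel)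
qed

lemma edge_steps_relabel:
  assumes m: "m \<ge> 1" and d: "d > - real m" and s: "s \<ge> 1" and perm: "\<phi> permutes {..s}"
    and st: "pa_state m s m g" "pa_state m s m (relabel \<phi> g)"
  shows "edge_steps m d (Suc s) i (relabel \<phi> g) = map_pmf (relabel \<phi>) (edge_steps m d (Suc s) i g)"
proof (induction i)
  case 0
  have "\<phi> (Suc s) = Suc s" by (rule permutes_not_in[OF perm]) simp
  then show ?case by (simp add: relabel_add_vertex)
next
  case (Suc i)
  have phi_fix: "\<phi> (Suc s) = Suc s" by (rule permutes_not_in[OF perm]) simp
  have st': "pa_state m (Suc s) i h" "pa_state m (Suc s) i (relabel \<phi> h)"
    if "h \<in> set_pmf (edge_steps m d (Suc s) i g)" for h
    using pa_state_edge_steps[OF m d s st(1) that]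
      pa_state_edge_steps[OF m d s st(2), of "relabel \<phi> h" i] that Suc.IH by auto
  show ?case
    unfolding edge_steps.simps Suc.IH bind_map_pmf map_bind_pmf
    using m d s perm st'
    by (intro bind_pmf_cong refl)
       (simp add: attachment_relabel pmf.map_comp o_def relabel_add_edge phi_fix)
qed

lemma grow_relabel:
  assumes m: "m \<ge> 1" and "\<forall>d\<in>set ds. d > - real m" "s \<ge> 1" "\<phi> permutes {..s}"
    and "pa_state m s m g" "pa_state m s m (relabel \<phi> g)"
  shows "grow m ds s (relabel \<phi> g) = map_pmf (relabel \<phi>) (grow m ds s g)"
  using assms(2-)
proof (induction ds arbitrary: s g)
  case (Cons d ds)
  have d: "d > - real m" using Cons.prems by simp
  have perm: "\<phi> permutes {..Suc s}"
    by (rule permutes_subset[OF Cons.prems(3)]) auto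
  have steps: "edge_steps m d (Suc s) m (relabel \<phi> g) = map_pmf (relabel \<phi>) (edge_steps m d (Suc s) m g)"
    using edge_steps_relabel[OF m d] Cons.prems by blast
  have st: "pa_state m (Suc s) m h" "pa_state m (Suc s) m (relabel \<phi> h)"
    if "h \<in> set_pmf (edge_steps m d (Suc s) m g)" for h
    using pa_state_edge_steps[OF m d Cons.prems(2,4) that]
      pa_state_edge_steps[OF m d Cons.prems(2,5), of "relabel \<phi> h" m] that steps by auto
  show ?case
    unfolding grow.simps steps bind_map_pmf map_bind_pmf
    using st perm Cons.prems by (intro bind_pmf_cong refl Cons.IH) auto
qed simp

section \<open>The price of moving a parameter\<close>

definition swap_cost :: "nat \<Rightarrow> real \<Rightarrow> real \<Rightarrow> real" where
  "swap_cost m a b = 2 * (real m * (drift m a + drift m b))"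

lemma drift_nonneg: "d > - real m \<Longrightarrow> drift m d \<ge> 0"
  by (simp add: drift_def)

lemma swap_cost_nonneg: "a > - real m \<Longrightarrow> b > - real m \<Longrightarrow> swap_cost m a b \<ge> 0"
  by (simp add: swap_cost_def drift_nonneg)

text \<open>Pass from the true rounds to the frozen ones, exchange the labels there, and return to the true
rounds in the other order. The later rounds commute with the relabelling, hence the probability
that the final structure lies in \<open>H\<close> is the same function of both frozen results.\<close>

lemma grow_swap:
  assumes m: "m \<ge> 1" and a: "a > - real m" and b: "b > - real m" and ds: "\<forall>d\<in>set ds. d > - real m"
    and t: "t \<ge> 1" and g: "pa_state m t m g"
    and H: "\<And>\<phi> h. bij \<phi> \<Longrightarrow> relabel \<phi> h \<in> H \<longleftrightarrow> h \<in> H"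
  shows "measure_pmf.prob (grow m (a # b # ds) t g) H
    \<le> measure_pmf.prob (grow m (b # a # ds) t g) H + swap_cost m a b / (real t + 1)"
proof -
  let ?\<phi> = "Transposition.transpose (Suc t) (Suc (Suc t))"
  define e where "e = real m * (drift m a + drift m b) / (real t + 1)"
  have e: "e \<ge> 0" using drift_nonneg a b by (simp add: e_def)
  define f where "f h = emeasure (grow m ds (Suc (Suc t)) h) H" for h
  have f1: "f h \<le> 1" for h by (simp add: f_def measure_pmf.emeasure_le_1)
  have em: "emeasure (grow m (a # b # ds) t g) H = (\<integral>\<^sup>+h. f h \<partial>two_rounds m a b t g)" for a b
    by (simp add: two_rounds_def f_def bind_assoc_pmf)
  have perm: "?\<phi> permutes {..Suc (Suc t)}" by (rule permutes_swap_id) auto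
  have inv: "f (relabel ?\<phi> h) = f h" if "h \<in> set_pmf (frozen_rounds m a b t g)" for h
  proof -
    have "relabel ?\<phi> h \<in> set_pmf (frozen_rounds m b a t g)"
      using that relabel_frozen_rounds[OF m a b t g, symmetric] by simp
    then have st: "pa_state m (Suc (Suc t)) m h" "pa_state m (Suc (Suc t)) m (relabel ?\<phi> h)"
      using that pa_state_frozen_rounds m a b t g by blast+
    have "f (relabel ?\<phi> h) = emeasure (grow m ds (Suc (Suc t)) h) (relabel ?\<phi> -` H)"
      unfolding f_def using grow_relabel[OF m ds _ perm st] by simp
    also have "relabel ?\<phi> -` H = H" using H[OF bij_transpose] by auto
    finally show ?thesis by (simp add: f_def)
  qed
  have "emeasure (grow m (a # b # ds) t g) H \<le> (\<integral>\<^sup>+h. f h \<partial>frozen_rounds m a b t g) + ennreal e"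
    unfolding em e_def using e[unfolded e_def]
    by (intro minorizes_integral_ge frozen_rounds_minorizes m a b t g f1)
  also have "(\<integral>\<^sup>+h. f h \<partial>frozen_rounds m a b t g) = (\<integral>\<^sup>+h. f (relabel ?\<phi> h) \<partial>frozen_rounds m a b t g)"
    by (intro nn_integral_cong_AE) (auto simp: AE_measure_pmf_iff inv)
  also have "\<dots> = (\<integral>\<^sup>+h. f h \<partial>frozen_rounds m b a t g)"
    unfolding relabel_frozen_rounds[OF m a b t g, symmetric] by simp
  also have "\<dots> \<le> emeasure (grow m (b # a # ds) t g) H + ennreal e"
    unfolding em e_def using e[unfolded e_def] frozen_rounds_minorizes[OF m b a t g]
    by (intro minorizes_integral_le f1) (simp_all add: add.commute)
  finally have "emeasure (grow m (a # b # ds) t g) H \<le> emeasure (grow m (b # a # ds) t g) H + ennreal (e + e)"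
    by (simp only: ennreal_plus[OF e e] add.assoc add_right_mono)
  then show ?thesis
    using e by (simp add: measure_pmf.emeasure_eq_measure e_def swap_cost_def flip: ennreal_plus)
qed

section \<open>The second moment of a randomly placed change\<close>

lemma Cauchy_Schwarz_pmf:
  fixes Y \<alpha> \<beta> :: "'a \<Rightarrow> ennreal"
  assumes "\<And>x. x \<in> set_pmf p \<Longrightarrow> (Y x)\<^sup>2 \<le> \<alpha> x * \<beta> x"
    and "\<And>x. x \<in> set_pmf p \<Longrightarrow> \<alpha> x < top" "\<And>x. x \<in> set_pmf p \<Longrightarrow> \<beta> x < top"
  shows "(\<integral>\<^sup>+x. Y x \<partial>measure_pmf p)\<^sup>2 \<le> (\<integral>\<^sup>+x. \<alpha> x \<partial>measure_pmf p) * (\<integral>\<^sup>+x. \<beta> x \<partial>measure_pmf p)"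
proof -
  define r :: "ennreal \<Rightarrow> ennreal" where "r z = ennreal (sqrt (enn2real z))" for z
  have r2: "(r z)\<^sup>2 = z" if "z < top" for z
    using that by (cases z) (auto simp: r_def ennreal_power)
  have le: "Y x \<le> r (\<alpha> x) * r (\<beta> x)" if x: "x \<in> set_pmf p" for x
  proof -
    obtain a b where ab: "\<alpha> x = ennreal a" "\<beta> x = ennreal b" "a \<ge> 0" "b \<ge> 0"
      using assms(2,3)[OF x] by (cases "\<alpha> x"; cases "\<beta> x") auto
    have sq: "(Y x)\<^sup>2 \<le> ennreal (a * b)" using assms(1)[OF x] ab by (simp add: ennreal_mult)
    then have "Y x \<noteq> top" by (auto simp: power2_eq_square ennreal_top_mult top_unique)
    then obtain y where y: "Y x = ennreal y" "y \<ge> 0" by (cases "Y x") auto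
    have "y\<^sup>2 \<le> a * b" using sq y ab by (simp add: ennreal_power)
    then have "y \<le> sqrt a * sqrt b" by (simp add: real_le_rsqrt flip: real_sqrt_mult)
    then show ?thesis using y ab by (simp add: r_def flip: ennreal_mult)
  qed
  have "(\<integral>\<^sup>+x. Y x \<partial>measure_pmf p)\<^sup>2 \<le> (\<integral>\<^sup>+x. r (\<alpha> x) * r (\<beta> x) \<partial>measure_pmf p)\<^sup>2"
    by (intro power_mono nn_integral_mono_AE) (auto simp: AE_measure_pmf_iff le)
  also have "\<dots> \<le> (\<integral>\<^sup>+x. (r (\<alpha> x))\<^sup>2 \<partial>measure_pmf p) * (\<integral>\<^sup>+x. (r (\<beta> x))\<^sup>2 \<partial>measure_pmf p)"
    by (rule Cauchy_Schwarz_nn_integral) auto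
  also have "(\<integral>\<^sup>+x. (r (\<alpha> x))\<^sup>2 \<partial>measure_pmf p) = (\<integral>\<^sup>+x. \<alpha> x \<partial>measure_pmf p)"
    by (intro nn_integral_cong_AE) (auto simp: AE_measure_pmf_iff r2 assms)
  also have "(\<integral>\<^sup>+x. (r (\<beta> x))\<^sup>2 \<partial>measure_pmf p) = (\<integral>\<^sup>+x. \<beta> x \<partial>measure_pmf p)"
    by (intro nn_integral_cong_AE) (auto simp: AE_measure_pmf_iff r2 assms)
  finally show ?thesis .
qed

lemma minorizes_density:
  assumes "minorizes (1 / M) q p" "M > 0"
  obtains r :: "'a \<Rightarrow> real" where "\<And>x. 0 \<le> r x" "\<And>x. r x \<le> M"
    "\<And>X. (\<integral>\<^sup>+x. X x \<partial>measure_pmf q) = (\<integral>\<^sup>+x. ennreal (r x) * X x \<partial>measure_pmf p)"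
proof
  define r where "r x = pmf q x / pmf p x" for x
  have dom: "pmf q x \<le> M * pmf p x" for x
    using minorizes_pmfD[OF assms(1), of x] assms(2) by (simp add: field_simps)
  show "0 \<le> r x" for x by (simp add: r_def)
  show "r x \<le> M" for x
    using dom[of x] assms(2) pmf_nonneg[of p x] by (cases "pmf p x = 0") (auto simp: r_def divide_le_eq)
  have "pmf p x * r x = pmf q x" for x
    using dom[of x] pmf_nonneg[of q x] by (cases "pmf p x = 0") (auto simp: r_def)
  then have *: "ennreal (pmf p x) * (ennreal (r x) * y) = ennreal (pmf q x) * y" for x y
    by (simp add: r_def flip: mult.assoc ennreal_mult)
  show "(\<integral>\<^sup>+x. X x \<partial>measure_pmf q) = (\<integral>\<^sup>+x. ennreal (r x) * X x \<partial>measure_pmf p)" for X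
    by (simp add: nn_integral_measure_pmf *)
qed

definition spike :: "real \<Rightarrow> real \<Rightarrow> nat \<Rightarrow> nat \<Rightarrow> real list" where
  "spike d d' b j = replicate j d @ d' # replicate (b - 1 - j) d"

lemma spike_0: "spike d d' (Suc b) 0 = d' # replicate b d"
  and spike_Suc: "spike d d' (Suc b) (Suc j) = d # spike d d' b j"
  by (simp_all add: spike_def)

lemma length_spike: "j < b \<Longrightarrow> length (spike d d' b j) = b"
  by (simp add: spike_def)

definition null_value :: "nat \<Rightarrow> real \<Rightarrow> nat \<Rightarrow> nat \<Rightarrow> (nat mgraph \<Rightarrow> ennreal) \<Rightarrow> nat mgraph \<Rightarrow> ennreal" where
  "null_value m d b t f g = (\<integral>\<^sup>+h. f h \<partial>grow m (replicate b d) t g)"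

definition spike_value ::
  "nat \<Rightarrow> real \<Rightarrow> real \<Rightarrow> nat \<Rightarrow> nat \<Rightarrow> (nat mgraph \<Rightarrow> ennreal) \<Rightarrow> nat mgraph \<Rightarrow> ennreal" where
  "spike_value m d d' b t f g = (\<Sum>j<b. \<integral>\<^sup>+h. f h \<partial>grow m (spike d d' b j) t g)"

lemma null_value_Suc:
  "null_value m d (Suc b) t f g = (\<integral>\<^sup>+h. null_value m d b (Suc t) f h \<partial>edge_steps m d (Suc t) m g)"
  by (simp add: null_value_def)

lemma spike_value_Suc:
  "spike_value m d d' (Suc b) t f g =
     (\<integral>\<^sup>+h. null_value m d b (Suc t) f h \<partial>edge_steps m d' (Suc t) m g) +
     (\<integral>\<^sup>+h. spike_value m d d' b (Suc t) f h \<partial>edge_steps m d (Suc t) m g)"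
  by (simp add: spike_value_def null_value_def sum.lessThan_Suc_shift spike_0 spike_Suc nn_integral_sum
      del: sum.lessThan_Suc)

lemma null_value_le_1:
  assumes "\<And>h. f h \<le> 1" shows "null_value m d b t f g \<le> 1"
  using nn_integral_mono[of "grow m (replicate b d) t g" f "\<lambda>_. 1"] assms
  by (simp add: null_value_def)

text \<open>The uniform mixture of the \<open>b\<close> spikes has density \<open>(r\<^sub>1 + \<dots> + r\<^sub>b) / b\<close> with respect to the
unchanged block, where \<open>r\<^sub>j\<close> is the likelihood ratio of round \<open>j\<close>. Given the past each \<open>r\<^sub>j\<close> has mean
1 and second moment at most \<open>M\<close>, and the cross terms \<open>r\<^sub>i r\<^sub>j\<close> have mean 1, so
\<open>E (a + r\<^sub>1 + \<dots> + r\<^sub>b)\<^sup>2 \<le> (a + b)\<^sup>2 + M b\<close>. The lemma states this dually, as an inequality for test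
functions, so that no density on the space of graphs has to be chosen globally. The offset \<open>a\<close> is
needed for the induction: after the first round it absorbs the ratio \<open>r\<^sub>1\<close>.\<close>

lemma spike_second_moment:
  fixes a :: ennreal
  assumes m: "m \<ge> 1" and d: "d > - real m" and d': "d' > - real m" and f: "\<And>h. f h \<le> 1"
    and "t \<ge> 1" "pa_state m t m g" "a < top"
  defines "M \<equiv> comparison m d d' ^ m"
  shows "(a * null_value m d b t f g + spike_value m d d' b t f g)\<^sup>2
    \<le> ((a + of_nat b)\<^sup>2 + ennreal M * of_nat b) * null_value m d b t (\<lambda>h. (f h)\<^sup>2) g"
  using assms(5-7)
proof (induction b arbitrary: a t g)
  case 0
  then show ?case by (simp add: null_value_def spike_value_def power_mult_distrib)
next
  case (Suc b)
  note t = \<open>t \<ge> 1\<close> and g = \<open>pa_state m t m g\<close>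
  have M1: "M \<ge> 1" unfolding M_def using comparison_ge_1[OF d d'] by (rule one_le_power)
  let ?p = "edge_steps m d (Suc t) m g" and ?q = "edge_steps m d' (Suc t) m g"
  let ?V = "\<lambda>f h. null_value m d b (Suc t) f h" and ?U = "\<lambda>h. spike_value m d d' b (Suc t) f h"
  have "minorizes (1 / M) ?q ?p"
    using edge_steps_minorizes[OF m d d' t g, of m] by (simp add: M_def power_one_over)
  from minorizes_density[OF this] M1 obtain r where r: "\<And>x. 0 \<le> r x" "\<And>x. r x \<le> M"
    and dens: "\<And>X. (\<integral>\<^sup>+x. X x \<partial>measure_pmf ?q) = (\<integral>\<^sup>+x. ennreal (r x) * X x \<partial>measure_pmf ?p)"
    by auto
  have r1: "(\<integral>\<^sup>+x. ennreal (r x) \<partial>?p) = 1" using dens[of "\<lambda>_. 1"] by simp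
  have "(\<integral>\<^sup>+x. ennreal (r x) * ennreal (r x) \<partial>?p) = (\<integral>\<^sup>+x. ennreal (r x) \<partial>?q)"
    by (rule dens[symmetric])
  also have "\<dots> \<le> (\<integral>\<^sup>+x. ennreal M \<partial>?q)" using r by (intro nn_integral_mono ennreal_leI) auto
  finally have r2: "(\<integral>\<^sup>+x. ennreal (r x) * ennreal (r x) \<partial>?p) \<le> ennreal M" by simp
  \<comment> \<open>The bound of the induction hypothesis for the offset \<open>a + r h\<close>.\<close>
  let ?\<alpha> = "\<lambda>h. ((a + ennreal (r h)) + of_nat b)\<^sup>2 + ennreal M * of_nat b"
  have "a * null_value m d (Suc b) t f g + spike_value m d d' (Suc b) t f g =
      (\<integral>\<^sup>+h. a * ?V f h \<partial>?p) + ((\<integral>\<^sup>+h. ennreal (r h) * ?V f h \<partial>?p) + (\<integral>\<^sup>+h. ?U h \<partial>?p))"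
    by (simp add: null_value_Suc spike_value_Suc dens nn_integral_cmult)
  also have "\<dots> = (\<integral>\<^sup>+h. (a + ennreal (r h)) * ?V f h + ?U h \<partial>?p)"
    by (simp add: nn_integral_add distrib_right add.assoc)
  finally have eq: "a * null_value m d (Suc b) t f g + spike_value m d d' (Suc b) t f g = \<dots>" .
  have "(\<integral>\<^sup>+h. (a + ennreal (r h)) * ?V f h + ?U h \<partial>?p)\<^sup>2
      \<le> (\<integral>\<^sup>+h. ?\<alpha> h \<partial>?p) * (\<integral>\<^sup>+h. ?V (\<lambda>h. (f h)\<^sup>2) h \<partial>?p)"
  proof (rule Cauchy_Schwarz_pmf)
    fix h assume h: "h \<in> set_pmf ?p"
    have fin: "a + ennreal (r h) < top" using \<open>a < top\<close> by simp
    show "((a + ennreal (r h)) * ?V f h + ?U h)\<^sup>2 \<le> ?\<alpha> h * ?V (\<lambda>h. (f h)\<^sup>2) h"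
      using pa_state_edge_steps[OF m d t g h] fin by (intro Suc.IH) auto
    have "a + ennreal (r h) + of_nat b < top"
      using fin of_nat_less_top[of b] by (simp add: less_top[symmetric])
    then show "?\<alpha> h < top"
      by (simp add: power2_eq_square ennreal_mult_less_top)
    have "?V (\<lambda>h. (f h)\<^sup>2) h \<le> 1" using f by (intro null_value_le_1 power_le_one) auto
    then show "?V (\<lambda>h. (f h)\<^sup>2) h < top" by (rule le_less_trans) simp
  qed
  also have "(\<integral>\<^sup>+h. ?\<alpha> h \<partial>?p) =
      (a + of_nat b)\<^sup>2 + 2 * (a + of_nat b) * (\<integral>\<^sup>+h. ennreal (r h) \<partial>?p) +
      (\<integral>\<^sup>+h. ennreal (r h) * ennreal (r h) \<partial>?p) + ennreal M * of_nat b"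
  proof -
    have expand: "?\<alpha> h = (a + of_nat b)\<^sup>2 + 2 * (a + of_nat b) * ennreal (r h) +
        ennreal (r h) * ennreal (r h) + ennreal M * of_nat b" for h
      by (simp only: power2_eq_square mult_2 mult_2_right distrib_left distrib_right ac_simps)
    show ?thesis unfolding expand by (simp add: nn_integral_add nn_integral_cmult)
  qed
  also have "\<dots> \<le> (a + of_nat b)\<^sup>2 + 2 * (a + of_nat b) * 1 + ennreal M + ennreal M * of_nat b"
    unfolding r1 by (intro add_mono r2 order_refl)
  also have "\<dots> \<le> (a + of_nat (Suc b))\<^sup>2 + ennreal M * of_nat (Suc b)"
  proof -
    have "(a + of_nat (Suc b))\<^sup>2 + ennreal M * of_nat (Suc b) =
        ((a + of_nat b)\<^sup>2 + 2 * (a + of_nat b) * 1 + ennreal M + ennreal M * of_nat b) + 1"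
      by (simp only: power2_eq_square mult_2 mult_2_right distrib_left distrib_right of_nat_Suc mult_1_right mult_1_left ac_simps)
    then show ?thesis by simp
  qed
  finally show ?case
    unfolding eq unfolding null_value_Suc by (simp add: mult_right_mono)
qed

primrec spikes :: "real \<Rightarrow> real \<Rightarrow> nat \<Rightarrow> nat \<Rightarrow> real list pmf" where
  "spikes d d' b 0 = return_pmf []"
| "spikes d d' b (Suc k) =
     pmf_of_set {..<b} \<bind> (\<lambda>j. map_pmf (\<lambda>w. spike d d' b j @ w) (spikes d d' b k))"

text \<open>The factors \<open>1 + M / b\<close> of the single blocks multiply. For \<open>b = k\<close> the product stays below \<open>exp M\<close>,
so the randomized process is dominated in \<open>L\<^sup>2\<close> by the unchanged one, uniformly in \<open>k\<close>.\<close>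

lemma spikes_second_moment:
  assumes m: "m \<ge> 1" and d: "d > - real m" and d': "d' > - real m" and f: "\<And>h. f h \<le> 1"
    and b: "b \<ge> 1" and "t \<ge> 1" "pa_state m t m g"
  shows "(\<integral>\<^sup>+w. \<integral>\<^sup>+h. f h \<partial>grow m w t g \<partial>spikes d d' b k)\<^sup>2
    \<le> ennreal (1 + comparison m d d' ^ m / real b) ^ k * null_value m d (b * k) t (\<lambda>h. (f h)\<^sup>2) g"
  using assms(6-7)
proof (induction k arbitrary: t g)
  case 0
  then show ?case by (simp add: null_value_def)
next
  case (Suc k)
  define M where "M = comparison m d d' ^ m"
  have M1: "M \<ge> 1" unfolding M_def using comparison_ge_1[OF d d'] by (rule one_le_power)
  define G where "G h = (\<integral>\<^sup>+w. \<integral>\<^sup>+h'. f h' \<partial>grow m w (t + b) h \<partial>spikes d d' b k)" for h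
  have G1: "G h \<le> 1" for h
  proof -
    have "(\<integral>\<^sup>+h'. f h' \<partial>grow m w (t + b) h) \<le> 1" for w
      using nn_integral_mono[of "grow m w (t + b) h" f "\<lambda>_. 1"] f by simp
    then show ?thesis
      using nn_integral_mono[of "spikes d d' b k" "\<lambda>w. \<integral>\<^sup>+h'. f h' \<partial>grow m w (t + b) h" "\<lambda>_. 1"]
      by (simp add: G_def)
  qed
  have split: "(\<integral>\<^sup>+w. \<integral>\<^sup>+h. f h \<partial>grow m (spike d d' b j @ w) t g \<partial>spikes d d' b k) =
      (\<integral>\<^sup>+h. G h \<partial>grow m (spike d d' b j) t g)" if "j < b" for j
  proof -
    have "(\<integral>\<^sup>+w. \<integral>\<^sup>+h. f h \<partial>grow m (spike d d' b j @ w) t g \<partial>spikes d d' b k) =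
        (\<integral>\<^sup>+h. f h \<partial>measure_pmf (spikes d d' b k \<bind> (\<lambda>w. grow m (spike d d' b j) t g \<bind> grow m w (t + b))))"
      using that by (simp add: grow_append length_spike)
    also have "\<dots> = (\<integral>\<^sup>+h. f h \<partial>measure_pmf (grow m (spike d d' b j) t g \<bind> (\<lambda>h. spikes d d' b k \<bind> (\<lambda>w. grow m w (t + b) h))))"
      by (subst bind_commute_pmf) (rule refl)
    finally show ?thesis by (simp add: G_def)
  qed
  have "(\<integral>\<^sup>+w. \<integral>\<^sup>+h. f h \<partial>grow m w t g \<partial>spikes d d' b (Suc k)) =
      (\<Sum>j<b. \<integral>\<^sup>+h. G h \<partial>grow m (spike d d' b j) t g) / of_nat b"
    using b by (simp add: nn_integral_pmf_of_set lessThan_empty_iff split)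
  also have "\<dots> = ennreal (1 / real b) * spike_value m d d' b t G g"
    using b by (simp add: spike_value_def divide_ennreal_def mult.commute inverse_ennreal ennreal_of_nat_eq_real_of_nat divide_inverse)
  finally have "(\<integral>\<^sup>+w. \<integral>\<^sup>+h. f h \<partial>grow m w t g \<partial>spikes d d' b (Suc k))\<^sup>2 =
      ennreal ((1 / real b)\<^sup>2) * (0 * null_value m d b t G g + spike_value m d d' b t G g)\<^sup>2"
    by (simp add: power_mult_distrib ennreal_power)
  also have "\<dots> \<le> ennreal ((1 / real b)\<^sup>2) *
      (((0 + of_nat b)\<^sup>2 + ennreal M * of_nat b) * null_value m d b t (\<lambda>h. (G h)\<^sup>2) g)"
    unfolding M_def by (intro mult_left_mono spike_second_moment m d d' G1 Suc.prems) auto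
  also have "\<dots> = ennreal (1 + M / real b) * null_value m d b t (\<lambda>h. (G h)\<^sup>2) g"
  proof -
    have "ennreal ((1 / real b)\<^sup>2) * ((0 + of_nat b)\<^sup>2 + ennreal M * of_nat b) =
        ennreal ((1 / real b)\<^sup>2 * ((real b)\<^sup>2 + M * real b))"
      using M1 by (simp add: ennreal_of_nat_eq_real_of_nat ennreal_power ennreal_mult ennreal_plus)
    also have "(1 / real b)\<^sup>2 * ((real b)\<^sup>2 + M * real b) = 1 + M / real b"
      using b by (simp add: field_simps power2_eq_square)
    finally show ?thesis by (simp flip: mult.assoc)
  qed
  also have "null_value m d b t (\<lambda>h. (G h)\<^sup>2) g \<le>
      (\<integral>\<^sup>+h. ennreal (1 + M / real b) ^ k * null_value m d (b * k) (t + b) (\<lambda>h. (f h)\<^sup>2) h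
        \<partial>grow m (replicate b d) t g)"
    unfolding null_value_def[of m d b]
  proof (intro nn_integral_mono_AE, unfold AE_measure_pmf_iff, intro ballI)
    fix h assume h: "h \<in> set_pmf (grow m (replicate b d) t g)"
    have "pa_state m (t + b) m h"
      using pa_state_grow[OF m _ Suc.prems h] d by simp
    then show "(G h)\<^sup>2 \<le> ennreal (1 + M / real b) ^ k * null_value m d (b * k) (t + b) (\<lambda>h. (f h)\<^sup>2) h"
      unfolding G_def M_def using Suc.prems by (intro Suc.IH) auto
  qed
  also have "\<dots> = ennreal (1 + M / real b) ^ k * null_value m d (b * Suc k) t (\<lambda>h. (f h)\<^sup>2) g"
    by (simp add: nn_integral_cmult null_value_def replicate_add grow_append)
  finally show ?case by (simp add: M_def mult.assoc mult_left_mono)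
qed

section \<open>Gathering the spikes at the end\<close>

lemma grow_prefix_mono:
  assumes "e \<ge> 0"
    and "\<And>h. h \<in> set_pmf (grow m us t g) \<Longrightarrow>
      measure_pmf.prob (grow m vs (t + length us) h) H
        \<le> measure_pmf.prob (grow m ws (t + length us) h) H + e"
  shows "measure_pmf.prob (grow m (us @ vs) t g) H \<le> measure_pmf.prob (grow m (us @ ws) t g) H + e"
proof -
  have "emeasure (grow m (us @ vs) t g) H =
      (\<integral>\<^sup>+h. emeasure (grow m vs (t + length us) h) H \<partial>grow m us t g)"
    by (simp add: grow_append)
  also have "\<dots> \<le> (\<integral>\<^sup>+h. emeasure (grow m ws (t + length us) h) H + ennreal e \<partial>grow m us t g)"
    using assms
    by (intro nn_integral_mono_AE)
       (auto simp: AE_measure_pmf_iff measure_pmf.emeasure_eq_measure simp flip: ennreal_plus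
         intro!: ennreal_leI)
  also have "\<dots> = emeasure (grow m (us @ ws) t g) H + ennreal e"
    by (simp add: grow_append nn_integral_add)
  finally show ?thesis
    using assms(1) by (simp add: measure_pmf.emeasure_eq_measure flip: ennreal_plus)
qed

text \<open>Each of the \<open>k\<close> adjacent swaps happens at a time not before \<open>T\<close> and is charged accordingly.\<close>

lemma grow_move:
  assumes m: "m \<ge> 1" and d: "d > - real m" and d': "d' > - real m" and ds: "\<forall>x\<in>set ds. x > - real m"
    and "T \<ge> 1" "T \<le> t" "pa_state m t m g"
    and H: "\<And>\<phi> h. bij \<phi> \<Longrightarrow> relabel \<phi> h \<in> H \<longleftrightarrow> h \<in> H"
  shows "measure_pmf.prob (grow m (replicate k d @ d' # ds) t g) H
    \<le> measure_pmf.prob (grow m (d' # replicate k d @ ds) t g) H + real k * (swap_cost m d d' / real T)"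
  using assms(6,7)
proof (induction k arbitrary: t g)
  case 0
  then show ?case by simp
next
  case (Suc k)
  let ?c = "swap_cost m d d' / real T"
  have c: "?c \<ge> 0" using swap_cost_nonneg[OF d d'] by simp
  have "measure_pmf.prob (grow m ([d] @ (replicate k d @ d' # ds)) t g) H
      \<le> measure_pmf.prob (grow m ([d] @ (d' # replicate k d @ ds)) t g) H + real k * ?c"
  proof (rule grow_prefix_mono)
    fix h assume h: "h \<in> set_pmf (grow m [d] t g)"
    have "pa_state m (t + length [d]) m h"
      using pa_state_grow[OF m _ _ Suc.prems(2) h] d Suc.prems assms(5) by simp
    then show "measure_pmf.prob (grow m (replicate k d @ d' # ds) (t + length [d]) h) H
        \<le> measure_pmf.prob (grow m (d' # replicate k d @ ds) (t + length [d]) h) H + real k * ?c"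
      using Suc.prems by (intro Suc.IH) auto
  qed (intro mult_nonneg_nonneg c of_nat_0_le_iff)
  also have "measure_pmf.prob (grow m ([d] @ (d' # replicate k d @ ds)) t g) H
      \<le> measure_pmf.prob (grow m (d' # d # replicate k d @ ds) t g) H + swap_cost m d d' / (real t + 1)"
    unfolding append_Cons append_Nil
  proof (rule grow_swap[OF m d d' _ _ Suc.prems(2) H])
    show "\<forall>x\<in>set (replicate k d @ ds). x > - real m" using ds d by auto
  qed (use Suc.prems assms(5) in auto)
  also have "swap_cost m d d' / (real t + 1) \<le> ?c"
    using swap_cost_nonneg[OF d d'] Suc.prems assms(5) by (intro divide_left_mono) auto
  finally show ?case by (simp add: algebra_simps add_divide_distrib)
qed

text \<open>The spike of the first block travels to the end of the word after the later blocks have been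
gathered. Each of the \<open>k\<close> spikes passes at most \<open>b k\<close> unchanged rounds.\<close>

lemma grow_gather:
  assumes m: "m \<ge> 1" and d: "d > - real m" and d': "d' > - real m" and b: "b \<ge> 1"
    and "T \<ge> 1" "T \<le> t" "pa_state m t m g" "ws \<in> set_pmf (spikes d d' b k)"
    and H: "\<And>\<phi> h. bij \<phi> \<Longrightarrow> relabel \<phi> h \<in> H \<longleftrightarrow> h \<in> H"
  shows "measure_pmf.prob (grow m (replicate ((b - 1) * k) d @ replicate k d') t g) H
    \<le> measure_pmf.prob (grow m ws t g) H + real (b * k\<^sup>2) * (swap_cost m d d' / real T)"
  using assms(6-8)
proof (induction k arbitrary: t g ws)
  case 0
  then show ?case by simp
next
  case (Suc k)
  let ?c = "swap_cost m d d' / real T"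
  have c: "?c \<ge> 0" using swap_cost_nonneg[OF d d'] by simp
  from Suc.prems(3) b obtain j w where j: "j < b" and w: "w \<in> set_pmf (spikes d d' b k)"
    and ws: "ws = spike d d' b j @ w"
    by (auto simp: set_pmf_of_set lessThan_empty_iff)
  let ?z = "b - 1 - j + (b - 1) * k"
  have "(b - 1) * Suc k = j + ?z" using j by simp
  then have "replicate ((b - 1) * Suc k) d @ replicate (Suc k) d' =
      replicate j d @ (replicate ?z d @ d' # replicate k d')"
    by (simp only: replicate_add append_assoc replicate_Suc)
  also have "measure_pmf.prob (grow m (replicate j d @ (replicate ?z d @ d' # replicate k d')) t g) H
      \<le> measure_pmf.prob (grow m (replicate j d @ (d' # replicate ?z d @ replicate k d')) t g) H + real ?z * ?c"
  proof (rule grow_prefix_mono)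
    fix h assume h: "h \<in> set_pmf (grow m (replicate j d) t g)"
    have "pa_state m (t + length (replicate j d)) m h"
      using pa_state_grow[OF m _ _ Suc.prems(2) h] d Suc.prems assms(5) by simp
    then show "measure_pmf.prob (grow m (replicate ?z d @ d' # replicate k d') (t + length (replicate j d)) h) H
        \<le> measure_pmf.prob (grow m (d' # replicate ?z d @ replicate k d') (t + length (replicate j d)) h) H + real ?z * ?c"
      using Suc.prems assms(5) d' by (intro grow_move m d d' H) auto
  qed (intro mult_nonneg_nonneg c of_nat_0_le_iff)
  also have "replicate j d @ (d' # replicate ?z d @ replicate k d') =
      spike d d' b j @ (replicate ((b - 1) * k) d @ replicate k d')"
    by (simp add: spike_def replicate_add)
  also have "measure_pmf.prob (grow m (spike d d' b j @ (replicate ((b - 1) * k) d @ replicate k d')) t g) H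
      \<le> measure_pmf.prob (grow m (spike d d' b j @ w) t g) H + real (b * k\<^sup>2) * ?c"
  proof (rule grow_prefix_mono)
    fix h assume h: "h \<in> set_pmf (grow m (spike d d' b j) t g)"
    have "pa_state m (t + length (spike d d' b j)) m h"
      using d d' Suc.prems assms(5) by (intro pa_state_grow[OF m _ _ Suc.prems(2) h]) (auto simp: spike_def)
    then show "measure_pmf.prob (grow m (replicate ((b - 1) * k) d @ replicate k d') (t + length (spike d d' b j)) h) H
        \<le> measure_pmf.prob (grow m w (t + length (spike d d' b j)) h) H + real (b * k\<^sup>2) * ?c"
      using Suc.prems w by (intro Suc.IH) auto
  qed (intro mult_nonneg_nonneg c of_nat_0_le_iff)
  finally have "measure_pmf.prob (grow m (replicate ((b - 1) * Suc k) d @ replicate (Suc k) d') t g) H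
      \<le> measure_pmf.prob (grow m ws t g) H + real (?z + b * k\<^sup>2) * ?c"
    by (simp only: ws of_nat_add distrib_right add_ac)
  also have "real (?z + b * k\<^sup>2) * ?c \<le> real (b * (Suc k)\<^sup>2) * ?c"
  proof (intro mult_right_mono c of_nat_mono)
    \<comment> \<open>The \<open>?z\<close> swaps of the new spike fit into \<open>(k + 1)\<^sup>2 - k\<^sup>2 = 2 k + 1\<close> lengths of a block.\<close>
    have "?z \<le> b + b * k" by (intro add_mono mult_right_mono) auto
    then show "?z + b * k\<^sup>2 \<le> b * (Suc k)\<^sup>2"
      by (simp add: power2_eq_square algebra_simps)
  qed
  finally show ?case by simp
qed

section \<open>Late changes are undetectable\<close>

text \<open>The additive term pays for spreading the changed rounds from the end to their random positions, the
square root comes from comparing the spread process with the unchanged one.\<close>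

lemma late_change_bound:
  assumes m: "m \<ge> 1" and d: "d > - real m" and d': "d' > - real m" and b: "b \<ge> 1" and T: "T \<ge> 1"
    and H: "\<And>\<phi> h. bij \<phi> \<Longrightarrow> relabel \<phi> h \<in> H \<longleftrightarrow> h \<in> H"
  shows "measure_pmf.prob (grow m (replicate (T - 1 + (b - 1) * k) d @ replicate k d') 1 (initial_graph m)) H
    \<le> sqrt ((1 + comparison m d d' ^ m / real b) ^ k *
          measure_pmf.prob (grow m (replicate (T - 1 + b * k) d) 1 (initial_graph m)) H)
      + real (b * k\<^sup>2) * (swap_cost m d d' / real T)"
proof -
  define C where "C = 1 + comparison m d d' ^ m / real b"
  define e where "e = real (b * k\<^sup>2) * (swap_cost m d d' / real T)"
  have e: "e \<ge> 0" using swap_cost_nonneg[OF d d'] by (simp add: e_def)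
  have C: "C \<ge> 0" using comparison_ge_1[OF d d'] by (simp add: C_def)
  let ?S = "grow m (replicate (T - 1) d) 1 (initial_graph m)"
  have st: "pa_state m T m g" if "g \<in> set_pmf ?S" for g
    using pa_state_grow[OF m _ _ initial_graph_state that] d T by simp
  define mix where "mix g = (\<integral>\<^sup>+w. emeasure (grow m w T g) H \<partial>spikes d d' b k)" for g
  have mix_alt: "mix g = (\<integral>\<^sup>+w. \<integral>\<^sup>+h. indicator H h \<partial>grow m w T g \<partial>spikes d d' b k)" for g
    by (simp add: mix_def)
  have le: "emeasure (grow m (replicate ((b - 1) * k) d @ replicate k d') T g) H \<le> mix g + ennreal e"
    if "g \<in> set_pmf ?S" for g
  proof -
    have "emeasure (grow m (replicate ((b - 1) * k) d @ replicate k d') T g) H =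
        (\<integral>\<^sup>+w. emeasure (grow m (replicate ((b - 1) * k) d @ replicate k d') T g) H \<partial>spikes d d' b k)"
      by simp
    also have "\<dots> \<le> (\<integral>\<^sup>+w. emeasure (grow m w T g) H + ennreal e \<partial>spikes d d' b k)"
      using grow_gather[OF m d d' b T order_refl st[OF that] _ H] e
      by (intro nn_integral_mono_AE)
         (auto simp: AE_measure_pmf_iff measure_pmf.emeasure_eq_measure e_def simp flip: ennreal_plus
           intro!: ennreal_leI)
    also have "\<dots> = mix g + ennreal e" by (simp add: nn_integral_add mix_def)
    finally show ?thesis .
  qed
  let ?P = "grow m (replicate (T - 1 + (b - 1) * k) d @ replicate k d') 1 (initial_graph m)"
  let ?Q = "grow m (replicate (T - 1 + b * k) d) 1 (initial_graph m)"
  have start: "grow m (replicate (T - 1) d @ ws) 1 (initial_graph m) = ?S \<bind> grow m ws T" for ws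
    using T by (subst grow_append) simp
  have P_eq: "?P = ?S \<bind> grow m (replicate ((b - 1) * k) d @ replicate k d') T"
    unfolding replicate_add append_assoc by (rule start)
  have Q_eq: "?Q = ?S \<bind> grow m (replicate (b * k) d) T"
    unfolding replicate_add by (rule start)
  have "emeasure ?P H = (\<integral>\<^sup>+g. emeasure (grow m (replicate ((b - 1) * k) d @ replicate k d') T g) H \<partial>?S)"
    unfolding P_eq by (rule emeasure_bind_pmf)
  also have "\<dots> \<le> (\<integral>\<^sup>+g. mix g + ennreal e \<partial>?S)"
    by (intro nn_integral_mono_AE, unfold AE_measure_pmf_iff, intro ballI le)
  also have "\<dots> = (\<integral>\<^sup>+g. mix g \<partial>?S) + ennreal e" by (simp add: nn_integral_add)
  finally have P: "emeasure ?P H \<le> (\<integral>\<^sup>+g. mix g \<partial>?S) + ennreal e" .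
  have "(\<integral>\<^sup>+g. mix g \<partial>?S)\<^sup>2 \<le> (\<integral>\<^sup>+g. 1 \<partial>?S) *
      (\<integral>\<^sup>+g. ennreal C ^ k * null_value m d (b * k) T (indicator H) g \<partial>?S)"
  proof (rule Cauchy_Schwarz_pmf)
    fix g assume g: "g \<in> set_pmf ?S"
    have ind: "(\<lambda>h. (indicator H h)\<^sup>2) = (indicator H :: _ \<Rightarrow> ennreal)"
      by (auto simp: indicator_def fun_eq_iff)
    have "(mix g)\<^sup>2 \<le> ennreal C ^ k * null_value m d (b * k) T (\<lambda>h. (indicator H h)\<^sup>2) g"
      unfolding mix_alt C_def
      by (intro spikes_second_moment m d d' b T st g) (auto simp: indicator_def)
    then show "(mix g)\<^sup>2 \<le> 1 * (ennreal C ^ k * null_value m d (b * k) T (indicator H) g)"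
      by (simp add: ind)
    have "null_value m d (b * k) T (indicator H) g \<le> 1"
      by (intro null_value_le_1) (auto simp: indicator_def)
    then have "null_value m d (b * k) T (indicator H) g < top" by (rule le_less_trans) simp
    then show "ennreal C ^ k * null_value m d (b * k) T (indicator H) g < top"
      using C by (simp add: ennreal_mult_less_top ennreal_power)
  qed simp
  also have "(\<integral>\<^sup>+g. ennreal C ^ k * null_value m d (b * k) T (indicator H) g \<partial>?S) =
      ennreal C ^ k * emeasure ?Q H"
    unfolding Q_eq emeasure_bind_pmf by (simp add: nn_integral_cmult null_value_def)
  finally have sq: "(\<integral>\<^sup>+g. mix g \<partial>?S)\<^sup>2 \<le> ennreal (C ^ k * measure_pmf.prob ?Q H)"
    using C by (simp add: measure_pmf.emeasure_eq_measure ennreal_power ennreal_mult)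
  then have "(\<integral>\<^sup>+g. mix g \<partial>?S) \<noteq> top" by (auto simp: power2_eq_square ennreal_top_mult top_unique)
  then obtain y where y: "(\<integral>\<^sup>+g. mix g \<partial>?S) = ennreal y" "y \<ge> 0"
    by (cases "\<integral>\<^sup>+g. mix g \<partial>?S") auto
  have "y\<^sup>2 \<le> C ^ k * measure_pmf.prob ?Q H" using sq y C by (simp add: ennreal_power)
  then have "y \<le> sqrt (C ^ k * measure_pmf.prob ?Q H)" by (rule real_le_rsqrt)
  moreover have "measure_pmf.prob ?P H \<le> y + e"
    using P y e by (simp add: measure_pmf.emeasure_eq_measure flip: ennreal_plus)
  ultimately show ?thesis by (simp add: C_def e_def)
qed

text \<open>Events in the structure algebra depend on the last graph only, and are invariant under all
relabellings of it.\<close>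

lemma structure_event:
  assumes "A \<in> sets structure_algebra"
  obtains H where "A = hd -` H" "\<And>\<phi> h. bij \<phi> \<Longrightarrow> relabel \<phi> h \<in> H \<longleftrightarrow> h \<in> H"
proof -
  obtain X where X: "A = (\<lambda>p. graph_structure (final_graph p)) -` X"
    using assms by (auto simp: structure_algebra_def sets_vimage_algebra2)
  show ?thesis
  proof
    show "A = hd -` {h. graph_structure h \<in> X}" by (auto simp: X final_graph_def)
  qed (simp add: graph_structure_relabel)
qed

text \<open>With \<open>k\<close> changed rounds, \<open>k\<close> blocks of length \<open>k\<close> balance the two requirements: the blocks have to be
of length at least of order \<open>k\<close> for the second moment to stay bounded, while all \<open>k\<close> changes move by
at most \<open>k\<^sup>2\<close> places, and each place costs \<open>O(1 / n)\<close>.\<close>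

lemma P1_le_P0:
  assumes m: "m \<ge> 1" and d: "d > - real m" and d': "d' > - real m"
    and \<tau>: "1 \<le> \<tau> n" "\<tau> n \<le> n" and k: "k = n - \<tau> n" and n: "k\<^sup>2 < n"
    and A: "A \<in> sets structure_algebra"
  shows "measure_pmf.prob (P1 m d d' \<tau> n) A
    \<le> sqrt (exp (comparison m d d' ^ m) * measure_pmf.prob (P0 m d n) A)
      + real (k ^ 3) * swap_cost m d d' / (real n - real (k\<^sup>2))"
proof -
  obtain H where A: "A = hd -` H" and H: "\<And>\<phi> h. bij \<phi> \<Longrightarrow> relabel \<phi> h \<in> H \<longleftrightarrow> h \<in> H"
    using structure_event[OF assms(8)] by metis
  define M where "M = comparison m d d' ^ m"
  have M: "M \<ge> 1" unfolding M_def using comparison_ge_1[OF d d'] by (rule one_le_power)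
  have prob: "measure_pmf.prob (pa_process m \<delta> n) A =
      measure_pmf.prob (grow m (map \<delta> [2..<Suc n]) 1 (initial_graph m)) H" for \<delta>
  proof -
    have "n \<ge> 1" using n by simp
    then show ?thesis unfolding A map_hd_pa_process[OF \<open>n \<ge> 1\<close>, symmetric] by simp
  qed
  have "map (\<lambda>t. d) [2..<Suc n] = replicate (n - 1) d" by (simp add: map_replicate_const del: upt_Suc)
  then have p0: "measure_pmf.prob (P0 m d n) A =
      measure_pmf.prob (grow m (replicate (n - 1) d) 1 (initial_graph m)) H"
    unfolding P0_def prob by simp
  have split: "[2..<Suc n] = [2..<Suc (\<tau> n)] @ [Suc (\<tau> n)..<Suc n]"
    using \<tau> upt_add_eq_append[of 2 "Suc (\<tau> n)" "n - \<tau> n"] by simp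
  have "map (\<lambda>t. d * of_bool (t \<le> \<tau> n) + d' * of_bool (t > \<tau> n)) [2..<Suc n] =
      map (\<lambda>_. d) [2..<Suc (\<tau> n)] @ map (\<lambda>_. d') [Suc (\<tau> n)..<Suc n]"
    unfolding split map_append by (intro arg_cong2[of _ _ _ _ "(@)"] map_cong) auto
  also have "\<dots> = replicate (n - 1 - k) d @ replicate k d'"
    using \<tau> k by (simp add: map_replicate_const del: upt_Suc)
  finally have p1: "measure_pmf.prob (P1 m d d' \<tau> n) A =
      measure_pmf.prob (grow m (replicate (n - 1 - k) d @ replicate k d') 1 (initial_graph m)) H"
    unfolding P1_def prob by simp
  show ?thesis
  proof (cases "k = 0")
    case True
    let ?p = "measure_pmf.prob (P0 m d n) A"
    have "?p * ?p \<le> 1 * ?p" by (intro mult_right_mono) auto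
    also have "\<dots> \<le> exp M * ?p" using M by (intro mult_right_mono) auto
    finally have "?p \<le> sqrt (exp M * ?p)" by (simp add: real_le_rsqrt power2_eq_square)
    then show ?thesis using True by (simp add: p0 p1 M_def)
  next
    case False
    then have k1: "k \<ge> 1" by simp
    define T where "T = n - k\<^sup>2"
    have T: "T \<ge> 1" "real T = real n - real (k\<^sup>2)" using n by (auto simp: T_def of_nat_diff)
    have kk: "k * k = (k - 1) * k + k" using k1 by (simp add: algebra_simps)
    have lens: "T - 1 + (k - 1) * k = n - 1 - k" "T - 1 + k * k = n - 1"
      using n kk by (simp_all add: T_def power2_eq_square)
    have "(1 + M / real k) ^ k \<le> exp (M / real k) ^ k"
      using M by (intro power_mono exp_ge_add_one_self) auto
    also have "\<dots> = exp M" using k1 by (simp flip: exp_of_nat_mult)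
    finally have C: "(1 + M / real k) ^ k \<le> exp M" .
    have "measure_pmf.prob (P1 m d d' \<tau> n) A \<le>
        sqrt ((1 + M / real k) ^ k * measure_pmf.prob (P0 m d n) A)
        + real (k * k\<^sup>2) * (swap_cost m d d' / real T)"
      using late_change_bound[OF m d d' k1 T(1) H, of k] unfolding lens p0 p1 M_def by simp
    also have "\<dots> \<le> sqrt (exp M * measure_pmf.prob (P0 m d n) A)
        + real (k * k\<^sup>2) * (swap_cost m d d' / real T)"
      using C by (intro add_right_mono real_sqrt_le_mono mult_right_mono) auto
    finally show ?thesis by (simp add: M_def T power3_eq_cube power2_eq_square mult_ac)
  qed
qed

theorem theorem3p1:
  fixes m :: nat and \<delta>0 \<delta>1 :: real and \<tau> :: "nat \<Rightarrow> nat" and A :: "nat \<Rightarrow> path set"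
  assumes "m \<ge> 1"
    and "\<delta>0 > - real m" and "\<delta>1 > - real m"
    and "\<And>n. n \<ge> 1 \<Longrightarrow> 1 \<le> \<tau> n \<and> \<tau> n \<le> n"
    and "(\<delta>0 > 0 \<and> (\<lambda>n. real (n - \<tau> n)) \<in> o(\<lambda>n. real n powr (1/3))) \<or>
         (\<delta>0 = 0 \<and> (\<lambda>n. real (n - \<tau> n)) \<in> o(\<lambda>n. real n powr (1/3) / ln (real n)))"
    and "\<And>n. n \<ge> 1 \<Longrightarrow> A n \<in> sets structure_algebra"
    and "(\<lambda>n. measure_pmf.prob (P0 m \<delta>0 n) (A n)) \<longlonglongrightarrow> 0"
  shows "(\<lambda>n. measure_pmf.prob (P1 m \<delta>0 \<delta>1 \<tau> n) (A n)) \<longlonglongrightarrow> 0"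
proof -
  define k where "k n = n - \<tau> n" for n
  \<comment> \<open>Both alternatives of the hypothesis imply that the number of changed rounds is \<open>o(n\<^sup>1\<^sup>/\<^sup>3)\<close>.\<close>
  have "(\<lambda>n. real n powr (1/3) / ln (real n)) \<in> O(\<lambda>n. real n powr (1/3))"
  proof (rule bigoI[where c = 1], rule eventually_mono[OF eventually_ge_at_top[of 3]])
    fix n :: nat assume "n \<ge> 3"
    then have "exp 1 \<le> real n" using exp_le by linarith
    then have "1 \<le> ln (real n)" using \<open>n \<ge> 3\<close> by (subst ln_ge_iff) auto
    then have "real n powr (1/3) / ln (real n) \<le> real n powr (1/3) / 1"
      by (intro divide_left_mono) auto
    then show "norm (real n powr (1/3) / ln (real n)) \<le> 1 * norm (real n powr (1/3))"
      using \<open>1 \<le> ln (real n)\<close> by simp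
  qed
  then have "(\<lambda>n. real (k n)) \<in> o(\<lambda>n. real n powr (1/3))"
    using assms(5) unfolding k_def by (auto intro: landau_o.small_big_trans)
  then have "(\<lambda>n. real (k n) / real n powr (1/3)) \<longlonglongrightarrow> 0" by (rule smalloD_tendsto)
  then have "(\<lambda>n. (real (k n) / real n powr (1/3)) ^ 3) \<longlonglongrightarrow> 0 ^ 3" by (rule tendsto_power)
  moreover have "(real (k n) / real n powr (1/3)) ^ 3 = real (k n ^ 3) / real n" for n
    by (cases "n = 0") (simp_all add: power_divide powr_power)
  ultimately have cube: "(\<lambda>n. real (k n ^ 3) / real n) \<longlonglongrightarrow> 0" by simp
  let ?M = "comparison m \<delta>0 \<delta>1 ^ m" and ?c = "swap_cost m \<delta>0 \<delta>1"
  have c: "?c \<ge> 0" using swap_cost_nonneg assms(2,3) .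
  let ?bound = "\<lambda>n. sqrt (exp ?M * measure_pmf.prob (P0 m \<delta>0 n) (A n)) + 2 * ?c * (real (k n ^ 3) / real n)"
  have "eventually (\<lambda>n. real (k n ^ 3) / real n < 1 / 2) sequentially"
    using cube by (rule order_tendstoD) simp
  then have bound: "eventually (\<lambda>n. measure_pmf.prob (P1 m \<delta>0 \<delta>1 \<tau> n) (A n) \<le> ?bound n) sequentially"
    using eventually_ge_at_top[of 1]
  proof eventually_elim
    case (elim n)
    \<comment> \<open>The randomized window of length \<open>k\<^sup>2\<close> occupies at most the last half of the time, so swaps in it cost \<open>O(1 / n)\<close>.\<close>
    have "k n ^ 2 \<le> k n ^ 3" by (cases "k n = 0") (simp_all add: power_increasing)
    then have "real ((k n)\<^sup>2) \<le> real (k n ^ 3)" by (rule of_nat_mono)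
    also have "real (k n ^ 3) < real n / 2" using elim by (simp add: divide_less_eq)
    finally have half: "real ((k n)\<^sup>2) < real n / 2" .
    also have "real n / 2 \<le> real n" by simp
    finally have less: "real ((k n)\<^sup>2) < real n" .
    then have "(k n)\<^sup>2 < n" unfolding of_nat_less_iff .
    then have "measure_pmf.prob (P1 m \<delta>0 \<delta>1 \<tau> n) (A n)
        \<le> sqrt (exp ?M * measure_pmf.prob (P0 m \<delta>0 n) (A n))
          + real (k n ^ 3) * ?c / (real n - real ((k n)\<^sup>2))"
      using assms(4)[OF elim(2)] assms(6)[OF elim(2)] assms(1-3)
      by (intro P1_le_P0) (auto simp: k_def)
    also have "real (k n ^ 3) * ?c / (real n - real ((k n)\<^sup>2)) \<le> real (k n ^ 3) * ?c / (real n / 2)"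
    proof (rule divide_left_mono)
      show "real n / 2 \<le> real n - real ((k n)\<^sup>2)" using half by linarith
      show "0 < (real n - real ((k n)\<^sup>2)) * (real n / 2)"
        using less elim(2) by (intro mult_pos_pos, linarith, simp)
    qed (use c in simp)
    finally show ?case by (simp add: mult_ac)
  qed
  have "?bound \<longlonglongrightarrow> sqrt (exp ?M * 0) + 2 * ?c * 0"
    by (intro tendsto_intros assms(7) cube)
  then have "?bound \<longlonglongrightarrow> 0" by simp
  from tendsto_sandwich[OF _ bound tendsto_const this] show ?thesis by simp
qed

end
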